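(* Let $U\in\mathbb{R}^{d\times n}$ be a frame and $z\in\mathbb{R}^n_{++}$. For any $0<\delta\le1$ there is $\hat z\in\mathbb{R}^n_{++}$ such that \[\|\mathrm{lev}^U(z)-\mathrm{lev}^U(\hat z)\|_1\le 2nd\delta\qquad\text{and}\qquad \log\frac{\hat z_{\max}}{\hat z_{\min}}\le n\log(\rho(U)/\delta).\]
   Context: A frame is a matrix $U=(u_1,\dots,u_n)\in\mathbb{R}^{d\times n}$ of full row rank; $U_T$ is the submatrix of columns indexed by $T$. For $z\in\mathbb{R}^n_{++}$, $Z=\mathrm{diag}(z)$ and $\mathrm{lev}^U_j(z):=z_ju_j^{\mathsf T}(UZU^{\mathsf T})^{-1}u_j$. $\hat z_{\max},\hat z_{\min}$ denote the largest and smallest entries of $\hat z$. For nonempty $T\subseteq[n]$, $\rho_T(U):=\|((UU^{\mathsf T})^{-1/2}U_T)^{+}\|_{\mathrm{op}}^2-1$, where ${}^{+}$ is the Moore–Penrose pseudo-inverse, and $\rho(U):=\max_{T}\rho_T(U)$. *)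

theory Defs
  imports "HOL-Analysis.Analysis"
begin

definition frame :: "real^'n^'d \<Rightarrow> bool" where
  "frame U \<longleftrightarrow> rank U = CARD('d)"

definition diag_mat :: "real^'n \<Rightarrow> real^'n^'n" where
  "diag_mat z = (\<chi> i j. if i = j then z $ i else 0)"

definition lev :: "real^'n^'d \<Rightarrow> real^'n \<Rightarrow> 'n \<Rightarrow> real" where
  "lev U z j = z $ j * (column j U \<bullet> (matrix_inv (U ** diag_mat z ** transpose U) *v column j U))"

definition pinv :: "real^'n^'m \<Rightarrow> real^'m^'n" where
  "pinv A = (THE X. A ** X ** A = A \<and> X ** A ** X = X \<and>
                    transpose (A ** X) = A ** X \<and> transpose (X ** A) = X ** A)"

definition opnorm :: "real^'n^'m \<Rightarrow> real" where
  "opnorm A = onorm (\<lambda>x. A *v x)"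

definition inv_sqrt :: "real^'n^'n \<Rightarrow> real^'n^'n" where
  "inv_sqrt A = (THE S. transpose S = S \<and> (\<forall>x. x \<noteq> 0 \<longrightarrow> x \<bullet> (S *v x) > 0) \<and>
                       S ** S = matrix_inv A)"

text \<open>Submatrix U_T, represented as U with the columns outside T replaced by zero
  (the pseudo-inverse then has the same nonzero rows, so operator norms agree).\<close>
definition colsub :: "real^'n^'d \<Rightarrow> 'n set \<Rightarrow> real^'n^'d" where
  "colsub U T = (\<chi> i j. if j \<in> T then U $ i $ j else 0)"

definition rhoT :: "real^'n^'d \<Rightarrow> 'n set \<Rightarrow> real" where
  "rhoT U T = (opnorm (pinv (colsub (inv_sqrt (U ** transpose U) ** U) T)))\<^sup>2 - 1"

definition rho :: "real^'n^'d \<Rightarrow> real" where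
  "rho U = Max {rhoT U T | T. T \<noteq> {}}"

end

theory Submission
  imports Defs
begin

text \<open>Leverage scores are unchanged when \<open>U\<close> is replaced by \<open>V = (U U\<^sup>T)\<^sup>-\<^sup>1\<^sup>/\<^sup>2 U\<close>, for which
  \<open>V V\<^sup>T = 1\<close>, and \<open>lev\<^sub>j(z) = z\<^sub>j sup\<^sub>x (2 v\<^sub>j \<bullet> x - \<Sum>\<^sub>i z\<^sub>i (v\<^sub>i \<bullet> x)\<^sup>2)\<close>. Call \<open>T\<close> a gap of \<open>z\<close> if every
  weight in \<open>T\<close> exceeds every weight outside \<open>T\<close> by a factor of more than \<open>\<rho>/\<delta>\<close>. Scaling down the
  weights in \<open>T\<close> until the factor is exactly \<open>\<rho>/\<delta>\<close> lowers the scores in \<open>T\<close> and raises the others;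
  since \<open>|x|\<^sup>2 \<le> (1 + \<rho>) \<Sum>\<^sub>i\<^sub>\<in>\<^sub>T (v\<^sub>i \<bullet> x)\<^sup>2\<close> on the span of the columns in \<open>T\<close>, the scores in \<open>T\<close> drop by
  a factor of at most \<open>1 + \<delta>\<close>. As the scores always sum to \<open>d\<close>, the \<open>l\<^sup>1\<close> change is at most \<open>2d\<delta>\<close>.
  The gaps form a chain, so at most \<open>n - 1\<close> such steps remove them all, and then the ratio of the
  extreme weights is at most \<open>(\<rho>/\<delta>)\<^sup>n\<close>. This needs \<open>\<rho> \<ge> \<delta>\<close>; indeed \<open>\<rho> \<ge> 1\<close> unless the nonzero columns
  of \<open>V\<close> are orthonormal, in which case the scores do not depend on \<open>z\<close>.\<close>

section \<open>Spectral theorem, square roots and pseudo-inverses\<close>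

text \<open>A first-order optimality condition in one variable, needed for the maximiser of a
  Rayleigh quotient: a nonzero linear term would win for small \<open>t\<close> of the sign opposite
  to \<open>a\<close>.\<close>

lemma linear_coeff_zero_if_quadratic_nonneg:
  fixes a b :: real
  assumes "\<And>t. 2 * t * a + t\<^sup>2 * b \<ge> 0" and "b \<ge> 0"
  shows "a = 0"
proof (rule ccontr)
  assume "a \<noteq> 0"
  \<comment> \<open>Dividing by \<open>b + 1\<close> rather than \<open>b\<close> also covers
    \<open>b = 0\<close>.\<close>
  have "2 * (- a / (b+1)) * a + (- a / (b+1))\<^sup>2 * b = a\<^sup>2 * (- b - 2) / (b+1)\<^sup>2"
  proof -
    have "a / (b + 1) * (b + 1) = a" using assms(2) by simp
    then show ?thesis using assms(2)
      by (simp add: power_divide diff_divide_distrib[symmetric] divide_simps) (simp add: algebra_simps power2_eq_square)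
  qed
  also have "\<dots> < 0"
    using \<open>a \<noteq> 0\<close> assms(2) by (intro divide_neg_pos mult_pos_neg) auto
  finally show False using assms(1)[of "- a / (b+1)"] by linarith
qed

text \<open>The vector \<open>b\<close> maximises the Rayleigh quotient on the unit sphere of
  \<open>W\<close>. Its first variation vanishes along all of \<open>W\<close>; invariance puts the
  residual \<open>f b - (b \<bullet> f b) *\<^sub>R b\<close> in \<open>W\<close>, so the residual
  is orthogonal to itself.\<close>

lemma self_adjoint_eigenvector:
  fixes f :: "'a::euclidean_space \<Rightarrow> 'a"
  assumes f: "linear f" and sa: "\<And>x y. f x \<bullet> y = x \<bullet> f y"
    and W: "subspace W" "f ` W \<subseteq> W" "W \<noteq> {0}"
  obtains b l where "b \<in> W" "norm b = 1" "f b = l *\<^sub>R b"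
proof -
  obtain w where w: "w \<in> W" "w \<noteq> 0" using W subspace_0 by blast
  have "(1 / norm w) *\<^sub>R w \<in> W \<inter> sphere 0 1" using w W(1) by (auto simp: subspace_scale)
  then have ne: "W \<inter> sphere 0 1 \<noteq> {}" by blast
  have comp: "compact (W \<inter> sphere 0 1)"
    using W(1) by (simp add: closed_Int_compact closed_subspace)
  have "continuous_on (W \<inter> sphere 0 1) (\<lambda>x. x \<bullet> f x)"
    by (intro continuous_intros linear_continuous_on linear_conv_bounded_linear[THEN iffD1] f)
  from continuous_attains_sup[OF comp ne this] obtain b where
    b: "b \<in> W" "norm b = 1" and mx: "\<And>x. x \<in> W \<Longrightarrow> norm x = 1 \<Longrightarrow> x \<bullet> f x \<le> b \<bullet> f b" by auto
  have bb: "b \<bullet> b = 1" using b(2) by (simp add: dot_square_norm)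
  have le: "x \<bullet> f x \<le> (b \<bullet> f b) * (x \<bullet> x)" if "x \<in> W" for x
  proof (cases "x = 0")
    case False
    have "(1 / norm x) *\<^sub>R x \<bullet> f ((1 / norm x) *\<^sub>R x) \<le> b \<bullet> f b"
      using that False W(1) by (intro mx) (auto simp: subspace_scale)
    then show ?thesis using False
      by (simp add: linear_scale[OF f] dot_square_norm field_simps power2_eq_square)
  qed (use linear_0[OF f] in auto)
  have crit: "(b \<bullet> f b) * (b \<bullet> w) - w \<bullet> f b = 0" if "w \<in> W" for w
  proof (rule linear_coeff_zero_if_quadratic_nonneg)
    fix t :: real
    have "b + t *\<^sub>R w \<in> W" using b that W(1) by (simp add: subspace_add subspace_scale)
    from le[OF this] have
      "0 \<le> (b \<bullet> f b) * ((b + t *\<^sub>R w) \<bullet> (b + t *\<^sub>R w)) - (b + t *\<^sub>R w) \<bullet> f (b + t *\<^sub>R w)" by simp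
    also have "\<dots> = 2 * t * ((b \<bullet> f b) * (b \<bullet> w) - w \<bullet> f b) + t\<^sup>2 * ((b \<bullet> f b) * (w \<bullet> w) - w \<bullet> f w)"
      using bb sa[of b w]
      by (simp add: linear_add[OF f] linear_scale[OF f] inner_add_left inner_add_right inner_commute
          algebra_simps power2_eq_square)
    finally show "0 \<le> 2 * t * ((b \<bullet> f b) * (b \<bullet> w) - w \<bullet> f b) + t\<^sup>2 * ((b \<bullet> f b) * (w \<bullet> w) - w \<bullet> f w)" .
  qed (use le[OF that] in auto)
  have "f b - (b \<bullet> f b) *\<^sub>R b \<in> W" using b W by (auto simp: subspace_diff subspace_scale)
  from crit[OF this] have "(f b - (b \<bullet> f b) *\<^sub>R b) \<bullet> (f b - (b \<bullet> f b) *\<^sub>R b) = 0"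
    by (simp add: algebra_simps inner_diff_left inner_diff_right inner_commute)
  then have "f b = (b \<bullet> f b) *\<^sub>R b" by simp
  with b show ?thesis by (rule that)
qed

text \<open>Induction on the dimension of \<open>W\<close>: split off one unit eigenvector; by
  self-adjointness its orthogonal complement in \<open>W\<close> is again invariant.\<close>

lemma self_adjoint_orthonormal_eigenbasis_subspace:
  fixes f :: "'a::euclidean_space \<Rightarrow> 'a"
  assumes f: "linear f" and sa: "\<And>x y. f x \<bullet> y = x \<bullet> f y"
    and W: "subspace W" "f ` W \<subseteq> W"
  shows "\<exists>B. finite B \<and> B \<subseteq> W \<and> (\<forall>b\<in>B. norm b = 1 \<and> (\<exists>l. f b = l *\<^sub>R b)) \<and>
    pairwise orthogonal B \<and> (\<forall>x\<in>W. (\<Sum>b\<in>B. (b \<bullet> x) *\<^sub>R b) = x)"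
  using W
proof (induction "dim W" arbitrary: W rule: less_induct)
  case (less W)
  show ?case
  proof (cases "W = {0}")
    case True
    then show ?thesis by (intro exI[of _ "{}"]) auto
  next
    case False
    obtain b l where b: "b \<in> W" "norm b = 1" "f b = l *\<^sub>R b"
      by (rule self_adjoint_eigenvector[OF f sa less.prems False])
    have bb: "b \<bullet> b = 1" using b(2) by (simp add: dot_square_norm)
    define W' where "W' = {x \<in> W. b \<bullet> x = 0}"
    have sub: "subspace W'" using less.prems(1)
      unfolding W'_def subspace_def by (auto simp: inner_add_right)
    have "b \<bullet> f x = 0" if "x \<in> W'" for x
    proof -
      have "b \<bullet> f x = l * (b \<bullet> x)" using sa[of b x] b(3) by (metis inner_scaleR_left)
      then show ?thesis using that by (simp add: W'_def)
    qed
    then have inv: "f ` W' \<subseteq> W'" using less.prems(2) by (auto simp: W'_def)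
    have "b \<notin> W'" using bb by (simp add: W'_def)
    then have "W' \<subset> W" using b(1) unfolding W'_def by blast
    then have "dim W' < dim W"
      using sub less.prems(1) by (intro dim_psubset) (simp add: span_eq_iff[THEN iffD2])
    from less.hyps[OF this sub inv] obtain B where B: "finite B" "B \<subseteq> W'"
      "\<forall>b\<in>B. norm b = 1 \<and> (\<exists>l. f b = l *\<^sub>R b)" "pairwise orthogonal B"
      "\<forall>x\<in>W'. (\<Sum>b\<in>B. (b \<bullet> x) *\<^sub>R b) = x" by blast
    have "b \<notin> B" using B(2) \<open>b \<notin> W'\<close> by blast
    have ortho: "b \<bullet> c = 0" if "c \<in> B" for c using that B(2) by (auto simp: W'_def)
    show ?thesis
    proof (intro exI[of _ "insert b B"] conjI ballI)
      show "pairwise orthogonal (insert b B)"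
        using B(4) ortho by (auto simp: pairwise_insert orthogonal_def inner_commute)
      fix x assume "x \<in> W"
      then have "x - (b \<bullet> x) *\<^sub>R b \<in> W'" using b(1) bb less.prems(1)
        by (simp add: W'_def subspace_diff subspace_scale inner_diff_right)
      with B(5) have "x - (b \<bullet> x) *\<^sub>R b = (\<Sum>c\<in>B. (c \<bullet> (x - (b \<bullet> x) *\<^sub>R b)) *\<^sub>R c)" by metis
      also have "\<dots> = (\<Sum>c\<in>B. (c \<bullet> x) *\<^sub>R c)"
        using ortho by (intro sum.cong) (auto simp: inner_diff_right inner_commute)
      finally show "(\<Sum>c\<in>insert b B. (c \<bullet> x) *\<^sub>R c) = x"
        using \<open>b \<notin> B\<close> B(1) by (simp add: add.commute diff_eq_eq)
    qed (use b B in \<open>auto simp: W'_def\<close>)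
  qed
qed

lemma symmetric_matrix_orthonormal_eigenbasis:
  fixes A :: "real^'n^'n"
  assumes "transpose A = A"
  shows "\<exists>B l. finite B \<and> (\<forall>b\<in>B. A *v b = l b *\<^sub>R b) \<and>
    (\<forall>b\<in>B. \<forall>c\<in>B. b \<bullet> c = (if b = c then 1 else 0)) \<and> (\<forall>x. (\<Sum>b\<in>B. (b \<bullet> x) *\<^sub>R b) = x)"
proof -
  have "(A *v x) \<bullet> y = x \<bullet> (A *v y)" for x y
    by (metis assms dot_lmul_matrix transpose_matrix_vector)
  from self_adjoint_orthonormal_eigenbasis_subspace[OF matrix_vector_mul_linear this, of UNIV]
  obtain B where B: "finite B" "\<forall>b\<in>B. norm b = 1 \<and> (\<exists>l. A *v b = l *\<^sub>R b)"
    "pairwise orthogonal B" "\<forall>x. (\<Sum>b\<in>B. (b \<bullet> x) *\<^sub>R b) = x" by auto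
  have "b \<bullet> c = (if b = c then 1 else 0)" if "b \<in> B" "c \<in> B" for b c
    using that B(2,3) by (auto simp: pairwise_def orthogonal_def dot_square_norm)
  moreover have "\<exists>l. \<forall>b\<in>B. A *v b = l b *\<^sub>R b" using B(2) by (intro bchoice) blast
  ultimately show ?thesis using B(1,4) by blast
qed

section \<open>Matrix identities through inner products\<close>

lemma matrix_eqI_inner:
  fixes A B :: "real^'n^'m"
  assumes "\<And>x y. x \<bullet> (A *v y) = x \<bullet> (B *v y)"
  shows "A = B"
  by (simp add: matrix_eq) (metis assms vector_eq_rdot inner_commute)

lemma inner_transpose_mult:
  fixes A :: "real^'n^'m"
  shows "x \<bullet> (transpose A *v y) = (A *v x) \<bullet> y"
  by (metis dot_lmul_matrix inner_commute transpose_matrix_vector)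

lemma symmetric_matrixI:
  fixes A :: "real^'n^'n"
  assumes "\<And>x y. x \<bullet> (A *v y) = (A *v x) \<bullet> y"
  shows "transpose A = A"
  by (rule matrix_eqI_inner) (simp only: inner_transpose_mult assms)

text \<open>Serves to define a matrix by its action along an eigenbasis, once for the square root
  and once for the pseudo-inverse.\<close>

lemma matrix_of_rank_one_sum_works:
  fixes B :: "(real^'n) set" and C :: "real^'n \<Rightarrow> real^'m"
  shows "matrix (\<lambda>x. \<Sum>b\<in>B. (C b \<bullet> x) *\<^sub>R b) *v x = (\<Sum>b\<in>B. (C b \<bullet> x) *\<^sub>R b)"
  by (rule matrix_works[OF iffD2[OF linear_matrix_vector_mul_eq]])
    (intro linear_compose_sum ballI bounded_linear.linear bounded_linear_intros)

section \<open>Square roots of positive definite matrices\<close>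

lemma pd_sqrt_exists:
  fixes A :: "real^'n^'n"
  assumes sym: "transpose A = A" and pd: "\<And>x. x \<noteq> 0 \<Longrightarrow> x \<bullet> (A *v x) > 0"
  shows "\<exists>S. transpose S = S \<and> (\<forall>x. x \<noteq> 0 \<longrightarrow> x \<bullet> (S *v x) > 0) \<and> S ** S = A"
proof -
  obtain B l where B: "finite B" "\<forall>b\<in>B. A *v b = l b *\<^sub>R b"
    "\<forall>b\<in>B. \<forall>c\<in>B. b \<bullet> c = (if b = c then 1 else 0)" "\<forall>x. (\<Sum>b\<in>B. (b \<bullet> x) *\<^sub>R b) = x"
    using symmetric_matrix_orthonormal_eigenbasis[OF sym] by blast
  have lpos: "l b > 0" if "b \<in> B" for b
  proof -
    have "b \<bullet> b = 1" using B(3) that by simp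
    then have "b \<noteq> 0" by auto
    from pd[OF this] show ?thesis using B(2) that \<open>b \<bullet> b = 1\<close> by simp
  qed
  \<comment> \<open>\<open>S\<close> keeps the eigenvectors of \<open>A\<close> and takes the square
    roots of the eigenvalues, which are positive by \<open>lpos\<close>.\<close>
  define S where "S = matrix (\<lambda>x. \<Sum>b\<in>B. ((sqrt (l b) *\<^sub>R b) \<bullet> x) *\<^sub>R b)"
  have S: "S *v x = (\<Sum>b\<in>B. (sqrt (l b) * (b \<bullet> x)) *\<^sub>R b)" for x
    unfolding S_def matrix_of_rank_one_sum_works by simp
  have xS: "x \<bullet> (S *v y) = (\<Sum>b\<in>B. sqrt (l b) * (b \<bullet> x) * (b \<bullet> y))" for x y
    unfolding S by (simp add: inner_sum_right mult_ac inner_commute)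
  have bS: "b \<bullet> (S *v x) = sqrt (l b) * (b \<bullet> x)" if "b \<in> B" for b x
    
  proof -
    have "b \<bullet> (S *v x) = (\<Sum>c\<in>B. if c = b then sqrt (l c) * (c \<bullet> x) else 0)"
      unfolding xS using that B(3) by (intro sum.cong) auto
    then show ?thesis using that B(1) by simp
  qed
  have "transpose S = S"
    by (rule symmetric_matrixI, subst (2) inner_commute) (simp add: xS mult_ac)
  moreover have "x \<bullet> (S *v x) > 0" if "x \<noteq> 0" for x
  proof -
    have "\<exists>b\<in>B. b \<bullet> x \<noteq> 0" using B(4) that by (metis (no_types, lifting) scaleR_zero_left sum.neutral)
    then obtain b where b: "b \<in> B" "b \<bullet> x \<noteq> 0" by blast
    have "0 < (\<Sum>b\<in>B. sqrt (l b) * (b \<bullet> x)\<^sup>2)"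
      using b lpos B(1) by (intro sum_pos2[of _ b]) (auto simp: less_imp_le)
    then show ?thesis by (simp add: xS power2_eq_square mult.assoc)
  qed
  moreover have "S ** S = A"
    unfolding matrix_eq
  proof
    fix x
    have "(S ** S) *v x = S *v (S *v x)" by (simp add: matrix_vector_mul_assoc)
    also have "\<dots> = (\<Sum>b\<in>B. (b \<bullet> x) *\<^sub>R (A *v b))"
      unfolding S[of "S *v x"]
    proof (intro sum.cong refl)
      fix b assume b: "b \<in> B"
      show "(sqrt (l b) * (b \<bullet> (S *v x))) *\<^sub>R b = (b \<bullet> x) *\<^sub>R (A *v b)"
        using lpos[OF b] B(2) b by (simp add: bS[OF b] mult.commute)
    qed
    also have "\<dots> = A *v (\<Sum>b\<in>B. (b \<bullet> x) *\<^sub>R b)"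
      by (simp add: linear_sum[OF matrix_vector_mul_linear] matrix_vector_mult_scaleR)
    finally show "(S ** S) *v x = A *v x" using B(4) by simp
  qed
  ultimately show ?thesis by blast
qed

text \<open>Diagonalise \<open>D = S - R\<close>. Since
  \<open>S ** D + D ** R = S ** S - R ** R = 0\<close>, pairing with a unit eigenvector
  \<open>b\<close> of \<open>D\<close> gives
  \<open>l b * (b \<bullet> (S *v b) + b \<bullet> (R *v b)) = 0\<close>, and the bracket is
  positive.\<close>

lemma pd_sqrt_unique:
  fixes S R :: "real^'n^'n"
  assumes S: "transpose S = S" "\<And>x. x \<noteq> 0 \<Longrightarrow> x \<bullet> (S *v x) > 0"
    and R: "transpose R = R" "\<And>x. x \<noteq> 0 \<Longrightarrow> x \<bullet> (R *v x) > 0"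
    and eq: "S ** S = R ** R"
  shows "S = R"
proof -
  define D where "D = S - R"
  have "transpose D = D" using S(1) R(1) by (simp add: D_def transpose_def vec_eq_iff)
  from symmetric_matrix_orthonormal_eigenbasis[OF this]
  obtain B l where B: "\<forall>b\<in>B. D *v b = l b *\<^sub>R b"
    "\<forall>b\<in>B. \<forall>c\<in>B. b \<bullet> c = (if b = c then 1 else 0)" "\<forall>x. (\<Sum>b\<in>B. (b \<bullet> x) *\<^sub>R b) = x"
    by blast
  have "D *v b = 0" if b: "b \<in> B" for b
  proof -
    have l: "D *v b = l b *\<^sub>R b" using B(1) b by simp
    have "b \<bullet> b = 1" using B(2) b by simp
    then have "b \<noteq> 0" by auto
    have "S *v (D *v b) + D *v (R *v b) = (S ** S) *v b - (R ** R) *v b"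
      by (simp only: D_def matrix_vector_mult_diff_rdistrib matrix_vector_mult_diff_distrib)
        (simp add: matrix_vector_mul_assoc)
    then have "S *v (D *v b) + D *v (R *v b) = 0" using eq by simp
    then have "0 = b \<bullet> (S *v (D *v b)) + b \<bullet> (D *v (R *v b))"
      by (metis inner_add_right inner_zero_right)
    also have "b \<bullet> (D *v (R *v b)) = (D *v b) \<bullet> (R *v b)"
      using \<open>transpose D = D\<close> by (metis inner_transpose_mult)
    also have "b \<bullet> (S *v (D *v b)) + (D *v b) \<bullet> (R *v b) = l b * (b \<bullet> (S *v b) + b \<bullet> (R *v b))"
      by (simp add: l matrix_vector_mult_scaleR algebra_simps)
    finally have "l b = 0" using S(2)[OF \<open>b \<noteq> 0\<close>] R(2)[OF \<open>b \<noteq> 0\<close>] by simp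
    then show ?thesis using l by simp
  qed
  have "D *v x = 0" for x
  proof -
    have "D *v x = D *v (\<Sum>b\<in>B. (b \<bullet> x) *\<^sub>R b)" using B(3) by simp
    also have "\<dots> = 0" using \<open>\<And>b. b \<in> B \<Longrightarrow> D *v b = 0\<close>
      by (simp add: linear_sum[OF matrix_vector_mul_linear] matrix_vector_mult_scaleR)
    finally show ?thesis .
  qed
  then have "D = 0" by (simp add: matrix_eq)
  then show ?thesis by (simp add: D_def)
qed

section \<open>The Moore-Penrose pseudo-inverse\<close>

lemma penrose_unique:
  fixes A :: "real^'n^'m"
  assumes X: "A ** X ** A = A" "X ** A ** X = X" "transpose (A ** X) = A ** X" "transpose (X ** A) = X ** A"
    and Y: "A ** Y ** A = A" "Y ** A ** Y = Y" "transpose (A ** Y) = A ** Y" "transpose (Y ** A) = Y ** A"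
  shows "X = Y"
proof -
  \<comment> \<open>Both \<open>A ** X\<close> and \<open>A ** Y\<close> are the orthogonal
    projection onto the range of \<open>A\<close>; their symmetry allows the product to be reversed.
    The same holds for \<open>X ** A\<close> and \<open>Y ** A\<close>, whence
    \<open>X ** A ** X = Y ** A ** Y\<close>.\<close>
  have "A ** X = (A ** Y) ** (A ** X)" by (metis Y(1) matrix_mul_assoc)
  also have "\<dots> = transpose ((A ** X) ** (A ** Y))" by (metis X(3) Y(3) matrix_transpose_mul)
  also have "\<dots> = A ** Y" by (metis X(1) Y(3) matrix_mul_assoc)
  finally have 1: "A ** X = A ** Y" .
  have "X ** A = (X ** A) ** (Y ** A)" by (metis Y(1) matrix_mul_assoc)
  also have "\<dots> = transpose ((Y ** A) ** (X ** A))" by (metis X(4) Y(4) matrix_transpose_mul)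
  also have "\<dots> = Y ** A" by (metis X(1) Y(4) matrix_mul_assoc)
  finally have 2: "X ** A = Y ** A" .
  show ?thesis by (metis 1 2 X(2) Y(2) matrix_mul_assoc)
qed

text \<open>The eigenvectors of \<open>transpose A ** A\<close> are right singular vectors: their
  images under \<open>A\<close> are mutually orthogonal with squared norms
  \<open>l b\<close>.\<close>

lemma penrose_exists:
  fixes A :: "real^'n^'m"
  shows "\<exists>X. A ** X ** A = A \<and> X ** A ** X = X \<and> transpose (A ** X) = A ** X \<and> transpose (X ** A) = X ** A"
proof -
  have "transpose (transpose A ** A) = transpose A ** A" by (simp add: matrix_transpose_mul)
  from symmetric_matrix_orthonormal_eigenbasis[OF this]
  obtain B l where B: "finite B" "\<forall>b\<in>B. (transpose A ** A) *v b = l b *\<^sub>R b"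
    "\<forall>b\<in>B. \<forall>c\<in>B. b \<bullet> c = (if b = c then 1 else 0)" "\<forall>x. (\<Sum>b\<in>B. (b \<bullet> x) *\<^sub>R b) = x"
    by blast
  have AA: "(A *v x) \<bullet> (A *v b) = l b * (x \<bullet> b)" if "b \<in> B" for b x
  proof -
    have "x \<bullet> (transpose A *v (A *v b)) = l b * (x \<bullet> b)"
      using B(2) that by (metis inner_scaleR_right matrix_vector_mul_assoc)
    then show ?thesis by (simp only: inner_transpose_mult)
  qed
  \<comment> \<open>Inverts \<open>A\<close> along each singular direction; the convention
    \<open>inverse 0 = 0\<close> discards the kernel.\<close>
  define X where "X = matrix (\<lambda>y. \<Sum>b\<in>B. ((inverse (l b) *\<^sub>R (A *v b)) \<bullet> y) *\<^sub>R b)"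
  have X: "X *v y = (\<Sum>b\<in>B. (inverse (l b) * ((A *v b) \<bullet> y)) *\<^sub>R b)" for y
    unfolding X_def matrix_of_rank_one_sum_works by simp
  have zero: "A *v b = 0" if "l b = 0" "b \<in> B" for b using that AA[of b b] by simp
  have inv: "inverse (l b) * (l b * c) = (if l b = 0 then 0 else c)" for b c by simp
  have XA: "X *v (A *v x) = (\<Sum>b\<in>B. (if l b = 0 then 0 else b \<bullet> x) *\<^sub>R b)" for x
    unfolding X by (rule sum.cong) (auto simp: AA inner_commute[of "A *v _" "A *v x"] inv inner_commute[of x])
  have AX: "A *v (X *v y) = (\<Sum>b\<in>B. (inverse (l b) * ((A *v b) \<bullet> y)) *\<^sub>R (A *v b))" for y
    unfolding X by (simp add: linear_sum[OF matrix_vector_mul_linear] matrix_vector_mult_scaleR)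
  have bX: "b \<bullet> (X *v y) = inverse (l b) * ((A *v b) \<bullet> y)" if "b \<in> B" for b y
    
  proof -
    have "b \<bullet> (X *v y) = (\<Sum>c\<in>B. if c = b then inverse (l c) * ((A *v c) \<bullet> y) else 0)"
      unfolding X inner_sum_right using that B(3) by (intro sum.cong) auto
    then show ?thesis using that B(1) by simp
  qed
  have "A *v (X *v (A *v x)) = A *v x" for x
  proof -
    have "A *v (X *v (A *v x)) = (\<Sum>b\<in>B. (b \<bullet> x) *\<^sub>R (A *v b))"
      unfolding XA by (simp add: linear_sum[OF matrix_vector_mul_linear] matrix_vector_mult_scaleR)
        (rule sum.cong, auto simp: zero)
    also have "\<dots> = A *v (\<Sum>b\<in>B. (b \<bullet> x) *\<^sub>R b)"
      by (simp add: linear_sum[OF matrix_vector_mul_linear] matrix_vector_mult_scaleR)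
    finally show ?thesis using B(4) by simp
  qed
  then have "A ** X ** A = A" by (simp add: matrix_eq matrix_vector_mul_assoc[symmetric])
  moreover have "X *v (A *v (X *v y)) = X *v y" for y
    unfolding XA by (subst X) (rule sum.cong, auto simp: bX)
  then have "X ** A ** X = X" by (simp add: matrix_eq matrix_vector_mul_assoc[symmetric])
  moreover have "transpose (A ** X) = A ** X"
    by (rule symmetric_matrixI)
      (auto simp: matrix_vector_mul_assoc[symmetric] AX inner_sum_left inner_sum_right inner_commute mult_ac intro!: sum.cong)
  moreover have "transpose (X ** A) = X ** A"
    by (rule symmetric_matrixI)
      (auto simp: matrix_vector_mul_assoc[symmetric] XA inner_sum_left inner_sum_right inner_commute mult_ac intro!: sum.cong)
  ultimately show ?thesis by blast
qed

lemma pinv_eqI: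
  fixes A :: "real^'n^'m"
  assumes "A ** X ** A = A" "X ** A ** X = X" "transpose (A ** X) = A ** X" "transpose (X ** A) = X ** A"
  shows "pinv A = X"
  unfolding pinv_def using assms penrose_unique[of A] by (intro the_equality) blast+

lemma pinv_penrose:
  fixes A :: "real^'n^'m"
  shows "A ** pinv A ** A = A" "pinv A ** A ** pinv A = pinv A"
    "transpose (A ** pinv A) = A ** pinv A" "transpose (pinv A ** A) = pinv A ** A"
  using penrose_exists[of A] pinv_eqI[of A] by metis+

text \<open>On the range of \<open>A\<close> the matrix \<open>A ** pinv A\<close> acts as the
  identity, so \<open>x \<bullet> x = (transpose A *v x) \<bullet> (pinv A *v x)\<close>;
  Cauchy-Schwarz and division by \<open>norm x\<close> finish.\<close>

lemma inner_self_le_opnorm_pinv: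
  fixes A :: "real^'n^'m"
  assumes "x = A *v y"
  shows "x \<bullet> x \<le> (opnorm (pinv A))\<^sup>2 * ((transpose A *v x) \<bullet> (transpose A *v x))"
proof -
  define w where "w = transpose A *v x"
  have n: "norm (pinv A *v x) \<le> opnorm (pinv A) * norm x"
    unfolding opnorm_def by (intro onorm matrix_vector_mul_bounded_linear)
  have "x = (A ** pinv A) *v x" using pinv_penrose(1)[of A] assms
    by (metis matrix_vector_mul_assoc)
  then have "x \<bullet> x = x \<bullet> (A *v (pinv A *v x))" by (simp add: matrix_vector_mul_assoc)
  also have "\<dots> = w \<bullet> (pinv A *v x)"
    unfolding w_def by (metis inner_transpose_mult transpose_transpose)
  also have "\<dots> \<le> norm w * (opnorm (pinv A) * norm x)"
    by (rule order_trans[OF norm_cauchy_schwarz mult_left_mono[OF n]]) simp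
  finally have "norm x * norm x \<le> (opnorm (pinv A) * norm w) * norm x"
    by (simp add: dot_square_norm power2_eq_square mult_ac)
  then have "norm x \<le> opnorm (pinv A) * norm w" if "x \<noteq> 0" using that by simp
  moreover have "0 \<le> opnorm (pinv A) * norm w"
    unfolding opnorm_def by (intro mult_nonneg_nonneg onorm_pos_le matrix_vector_mul_bounded_linear) auto
  ultimately have "norm x \<le> opnorm (pinv A) * norm w" by (cases "x = 0") auto
  then have "(norm x)\<^sup>2 \<le> (opnorm (pinv A) * norm w)\<^sup>2" by (simp add: power_mono)
  then show ?thesis by (simp add: dot_square_norm power_mult_distrib w_def)
qed

section \<open>Dual formula for leverage scores\<close>

text \<open>The quadratic form of \<open>U ** diag_mat z ** transpose U\<close>, written over
  columns so that it can be compared weight by weight and split along a set of indices.\<close>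

definition wquad :: "real^'n^'d \<Rightarrow> real^'n \<Rightarrow> real^'d \<Rightarrow> real" where
  "wquad U z x = (\<Sum>i\<in>UNIV. z $ i * (column i U \<bullet> x)\<^sup>2)"

lemma transpose_mult_component:
  fixes U :: "real^'n^'d"
  shows "(transpose U *v x) $ i = column i U \<bullet> x"
  by (simp add: matrix_vector_mult_def transpose_def column_def inner_vec_def)

lemma frame_operator_mult:
  fixes U :: "real^'n^'d"
  shows "(U ** diag_mat z ** transpose U) *v x = (\<Sum>i\<in>UNIV. (z $ i * (column i U \<bullet> x)) *\<^sub>R column i U)"
proof -
  have "(diag_mat z *v y) $ i = z $ i * y $ i" for y i
    by (simp add: diag_mat_def matrix_vector_mult_def if_distrib[of "\<lambda>a. a * _"] cong: if_cong)
  then have "(diag_mat z *v (transpose U *v x)) $ i = z $ i * (column i U \<bullet> x)" for i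
    by (simp only: transpose_mult_component)
  moreover have "(U ** diag_mat z ** transpose U) *v x = U *v (diag_mat z *v (transpose U *v x))"
    by (simp only: matrix_vector_mul_assoc matrix_mul_assoc)
  ultimately show ?thesis
    by (simp only: matrix_mult_sum scalar_mult_eq_scaleR)
qed

lemma inner_frame_operator:
  fixes U :: "real^'n^'d"
  shows "y \<bullet> ((U ** diag_mat z ** transpose U) *v x) = (\<Sum>i\<in>UNIV. z $ i * (column i U \<bullet> x) * (column i U \<bullet> y))"
  unfolding frame_operator_mult by (simp add: inner_sum_right inner_commute)

lemma wquad_eq_inner: "wquad U z x = x \<bullet> ((U ** diag_mat z ** transpose U) *v x)"
  unfolding inner_frame_operator wquad_def by (simp add: power2_eq_square mult.assoc)

lemma wquad_nonneg:
  assumes "\<And>j. z $ j \<ge> 0" shows "wquad U z x \<ge> 0"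
  unfolding wquad_def by (intro sum_nonneg mult_nonneg_nonneg assms) auto

lemma wquad_scaleR: "wquad U z (a *\<^sub>R x) = a\<^sup>2 * wquad U z x"
  unfolding wquad_def by (simp add: sum_distrib_left power_mult_distrib mult_ac)

lemma frame_columns_separate:
  fixes U :: "real^'n^'d"
  assumes "frame U" and "\<And>i. column i U \<bullet> x = 0"
  shows "x = 0"
proof -
  obtain y where "x = U *v y"
    using assms(1) unfolding frame_def full_rank_surjective by (metis surjD)
  then have "x \<bullet> x = (\<Sum>i\<in>UNIV. y $ i * (x \<bullet> column i U))"
    by (metis (no_types, lifting) inner_scaleR_right inner_sum_right matrix_mult_sum scalar_mult_eq_scaleR sum.cong)
  also have "\<dots> = 0" using assms(2) by (simp add: inner_commute)
  finally show ?thesis by simp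
qed

lemma wquad_pos:
  fixes U :: "real^'n^'d"
  assumes "frame U" and "\<And>j. z $ j > 0" and "x \<noteq> 0"
  shows "wquad U z x > 0"
proof -
  obtain i where "column i U \<bullet> x \<noteq> 0" using frame_columns_separate[OF assms(1)] assms(3) by blast
  then show ?thesis unfolding wquad_def
    using assms(2) by (intro sum_pos2[of _ i]) (auto simp: less_imp_le)
qed

lemma invertible_if_pd:
  fixes A :: "real^'n^'n"
  assumes "\<And>x. x \<noteq> 0 \<Longrightarrow> x \<bullet> (A *v x) > 0"
  shows "invertible A"
  unfolding invertible_left_inverse matrix_left_invertible_ker using assms
  by (metis inner_zero_right less_irrefl)

lemma matrix_inv_mult:
  fixes A :: "real^'n^'n"
  assumes "invertible A"
  shows "A ** matrix_inv A = mat 1" "matrix_inv A ** A = mat 1"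
  using assms unfolding invertible_def matrix_inv_def
  by (metis (mono_tags, lifting) someI_ex)+

lemma frame_operator_invertible:
  fixes U :: "real^'n^'d"
  assumes "frame U" "\<And>j. z $ j > 0"
  shows "invertible (U ** diag_mat z ** transpose U)"
  using wquad_pos[OF assms] unfolding wquad_eq_inner by (rule invertible_if_pd)

text \<open>An explicit solution of the linear system can thus replace the inverse matrix.\<close>

lemma lev_eqI:
  fixes U :: "real^'n^'d"
  assumes "frame U" "\<And>j. z $ j > 0" "(U ** diag_mat z ** transpose U) *v x = column j U"
  shows "lev U z j = z $ j * (column j U \<bullet> x)"
proof -
  have "matrix_inv (U ** diag_mat z ** transpose U) *v column j U = x"
    by (subst assms(3)[symmetric])
      (simp only: matrix_vector_mul_assoc matrix_inv_mult(2)[OF frame_operator_invertible[OF assms(1,2)]] matrix_vector_mul_lid)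
  then show ?thesis by (simp add: lev_def)
qed

lemma lev_solution:
  fixes U :: "real^'n^'d"
  assumes "frame U" "\<And>j. z $ j > 0"
  obtains x where "(U ** diag_mat z ** transpose U) *v x = column j U"
proof
  show "(U ** diag_mat z ** transpose U) *v (matrix_inv (U ** diag_mat z ** transpose U) *v column j U) = column j U"
    by (simp only: matrix_vector_mul_assoc matrix_inv_mult(1)[OF frame_operator_invertible[OF assms]] matrix_vector_mul_lid)
qed

lemma column_matrix_mult: "column j (S ** U) = S *v column j (U :: real^'n^'d)"
  by (simp add: column_def matrix_matrix_mult_def matrix_vector_mult_def)

lemma frame_left_mult:
  fixes U :: "real^'n^'d" and S :: "real^'d^'d"
  assumes "frame U" "invertible S" shows "frame (S ** U)"
proof -
  have "surj ((*v) U)" using assms(1) by (simp add: frame_def full_rank_surjective)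
  moreover have "surj ((*v) S)"
    using assms(2) invertible_right_inverse matrix_right_invertible_surjective by blast
  ultimately have "surj ((*v) S \<circ> (*v) U)" using comp_surj by blast
  then show ?thesis by (simp add: frame_def full_rank_surjective o_def matrix_vector_mul_assoc)
qed

text \<open>A solution \<open>x\<close> of the system for \<open>S ** U\<close> yields the solution
  \<open>transpose S *v x\<close> for \<open>U\<close> after cancelling \<open>S\<close>, and the
  inner products with the respective columns agree. This permits passing to a Parseval
  frame.\<close>

lemma lev_left_mult:
  fixes U :: "real^'n^'d" and S :: "real^'d^'d"
  assumes U: "frame U" and z: "\<And>j. z $ j > 0" and S: "invertible S"
  shows "lev (S ** U) z j = lev U z j"
proof -
  obtain x where x: "((S ** U) ** diag_mat z ** transpose (S ** U)) *v x = column j (S ** U)"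
    using lev_solution[OF frame_left_mult[OF U S] z] by metis
  have "S *v ((U ** diag_mat z ** transpose U) *v (transpose S *v x)) = S *v column j U"
    using x by (simp only: column_matrix_mult matrix_transpose_mul matrix_vector_mul_assoc matrix_mul_assoc)
  then have "matrix_inv S *v (S *v ((U ** diag_mat z ** transpose U) *v (transpose S *v x)))
      = matrix_inv S *v (S *v column j U)" by simp
  then have "(U ** diag_mat z ** transpose U) *v (transpose S *v x) = column j U"
    by (simp only: matrix_vector_mul_assoc[of "matrix_inv S" S] matrix_inv_mult(2)[OF S] matrix_vector_mul_lid)
  from lev_eqI[OF U z this] lev_eqI[OF frame_left_mult[OF U S] z x] show ?thesis
    by (simp only: column_matrix_mult inner_transpose_mult)
qed

text \<open>Expand \<open>wquad U z (w - x) \<ge> 0\<close> at the solution \<open>w\<close> of the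
  system for column \<open>j\<close>. Scores for different weights are later compared by choosing
  the test vector \<open>x\<close>.\<close>

lemma lev_ge_dual:
  fixes U :: "real^'n^'d"
  assumes U: "frame U" and z: "\<And>j. z $ j > 0"
  shows "z $ j * (2 * (column j U \<bullet> x) - wquad U z x) \<le> lev U z j"
proof -
  let ?M = "U ** diag_mat z ** transpose U"
  obtain w where w: "?M *v w = column j U" using lev_solution[OF U z] by metis
  have sym: "w \<bullet> (?M *v x) = x \<bullet> (?M *v w)" unfolding inner_frame_operator by (simp add: mult_ac)
  have "0 \<le> wquad U z (w - x)" using z by (simp add: wquad_nonneg less_imp_le)
  also have "\<dots> = w \<bullet> (?M *v w) - 2 * (x \<bullet> (?M *v w)) + x \<bullet> (?M *v x)"
    unfolding wquad_eq_inner using sym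
    by (simp add: matrix_vector_mult_diff_distrib inner_diff_left inner_diff_right)
  finally have "2 * (column j U \<bullet> x) - wquad U z x \<le> column j U \<bullet> w"
    unfolding wquad_eq_inner w by (simp add: inner_commute)
  then show ?thesis unfolding lev_eqI[OF U z w] using z[of j] by (simp add: mult_left_mono)
qed

text \<open>Equality occurs at the solution \<open>w\<close>, where the quadratic form equals
  \<open>column j U \<bullet> w\<close>.\<close>

lemma lev_eq_dual:
  fixes U :: "real^'n^'d"
  assumes U: "frame U" and z: "\<And>j. z $ j > 0"
  obtains x where "lev U z j = z $ j * (2 * (column j U \<bullet> x) - wquad U z x)"
proof -
  obtain w where w: "(U ** diag_mat z ** transpose U) *v w = column j U" using lev_solution[OF U z] by metis
  then have "wquad U z w = column j U \<bullet> w" by (simp add: wquad_eq_inner inner_commute)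
  then show ?thesis using that[of w] lev_eqI[OF U z w] by simp
qed

lemma lev_nonneg:
  fixes U :: "real^'n^'d"
  assumes "frame U" and "\<And>j. z $ j > 0"
  shows "0 \<le> lev U z j"
  using lev_ge_dual[OF assms, of j 0] by (simp add: wquad_def)

text \<open>The trace of the identity, written as the frame operator times its inverse; swapping the
  two sums plays the part of cyclicity of the trace.\<close>

lemma sum_lev:
  fixes U :: "real^'n^'d"
  assumes U: "frame U" and z: "\<And>j. z $ j > 0"
  shows "(\<Sum>j\<in>UNIV. lev U z j) = CARD('d)"
proof -
  define N where "N = matrix_inv (U ** diag_mat z ** transpose U)"
  have "real CARD('d) = (\<Sum>b\<in>Basis. b \<bullet> ((b :: real^'d)))"
    by (simp add: inner_same_Basis)
  also have "\<dots> = (\<Sum>b\<in>Basis. b \<bullet> ((U ** diag_mat z ** transpose U) *v (N *v b)))"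
    unfolding N_def by (simp only: matrix_vector_mul_assoc matrix_inv_mult(1)[OF frame_operator_invertible[OF U z]] matrix_vector_mul_lid)
  also have "\<dots> = (\<Sum>b\<in>Basis. \<Sum>i\<in>UNIV. z $ i * (column i U \<bullet> (N *v b)) * (column i U \<bullet> b))"
    unfolding inner_frame_operator ..
  also have "\<dots> = (\<Sum>i\<in>UNIV. \<Sum>b\<in>Basis. z $ i * (column i U \<bullet> (N *v b)) * (column i U \<bullet> b))"
    by (rule sum.swap)
  also have "\<dots> = (\<Sum>i\<in>UNIV. lev U z i)"
  proof (rule sum.cong)
    fix i :: 'n
    have "N *v column i U = N *v (\<Sum>b\<in>Basis. (column i U \<bullet> b) *\<^sub>R b)" by (simp add: euclidean_representation)
    also have "\<dots> = (\<Sum>b\<in>Basis. (column i U \<bullet> b) *\<^sub>R (N *v b))"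
      by (simp add: linear_sum[OF matrix_vector_mul_linear] matrix_vector_mult_scaleR)
    finally show "(\<Sum>b\<in>Basis. z $ i * (column i U \<bullet> (N *v b)) * (column i U \<bullet> b)) = lev U z i"
      by (simp add: lev_def N_def[symmetric] inner_sum_right sum_distrib_left mult_ac)
  qed simp
  finally show ?thesis by simp
qed

section \<open>Conditioning of Parseval frames\<close>

text \<open>Gives access to the definite description in \<open>inv_sqrt\<close>:
  \<open>matrix_inv A\<close> is again symmetric and positive definite, so its positive definite
  square root exists and is unique.\<close>

lemma inv_sqrt_pd:
  fixes A :: "real^'n^'n"
  assumes sym: "transpose A = A" and pd: "\<And>x. x \<noteq> 0 \<Longrightarrow> x \<bullet> (A *v x) > 0"
  shows "transpose (inv_sqrt A) = inv_sqrt A" "\<And>x. x \<noteq> 0 \<Longrightarrow> x \<bullet> (inv_sqrt A *v x) > 0"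
    "inv_sqrt A ** inv_sqrt A = matrix_inv A"
proof -
  have inv: "invertible A" using pd by (rule invertible_if_pd)
  note AN = matrix_inv_mult[OF inv]
  have "transpose (matrix_inv A) = transpose (matrix_inv A) ** (A ** matrix_inv A)"
    by (simp only: AN matrix_mul_rid)
  also have "\<dots> = transpose (A ** matrix_inv A) ** matrix_inv A"
    by (simp only: matrix_transpose_mul sym matrix_mul_assoc)
  finally have symN: "transpose (matrix_inv A) = matrix_inv A" by (simp only: AN transpose_mat matrix_mul_lid)
  have pdN: "x \<bullet> (matrix_inv A *v x) > 0" if "x \<noteq> 0" for x
  proof -
    define y where "y = matrix_inv A *v x"
    have x: "x = A *v y" unfolding y_def by (simp only: matrix_vector_mul_assoc AN matrix_vector_mul_lid)
    then have "y \<noteq> 0" using that by (metis matrix_vector_mult_0_right)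
    from pd[OF this] have "(A *v y) \<bullet> y > 0" by (simp only: inner_commute)
    then show ?thesis unfolding y_def[symmetric] x[symmetric] .
  qed
  have "\<exists>!S. transpose S = S \<and> (\<forall>x. x \<noteq> 0 \<longrightarrow> x \<bullet> (S *v x) > 0) \<and> S ** S = matrix_inv A"
  proof (rule ex_ex1I)
    show "\<exists>S. transpose S = S \<and> (\<forall>x. x \<noteq> 0 \<longrightarrow> x \<bullet> (S *v x) > 0) \<and> S ** S = matrix_inv A"
      using symN pdN by (rule pd_sqrt_exists)
    show "S = R" if "transpose S = S \<and> (\<forall>x. x \<noteq> 0 \<longrightarrow> x \<bullet> (S *v x) > 0) \<and> S ** S = matrix_inv A"
      "transpose R = R \<and> (\<forall>x. x \<noteq> 0 \<longrightarrow> x \<bullet> (R *v x) > 0) \<and> R ** R = matrix_inv A" for S R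
      
    proof (rule pd_sqrt_unique)
      show "S ** S = R ** R" using that by (elim conjE) (simp only:)
    qed (use that in blast)+
  qed
  from theI'[OF this, folded inv_sqrt_def]
  show "transpose (inv_sqrt A) = inv_sqrt A" "\<And>x. x \<noteq> 0 \<Longrightarrow> x \<bullet> (inv_sqrt A *v x) > 0"
    "inv_sqrt A ** inv_sqrt A = matrix_inv A" by blast+
qed

text \<open>With \<open>A\<close> for \<open>U ** transpose U\<close>, the equation
  \<open>S ** S = matrix_inv A\<close> gives
  \<open>S ** A ** S = matrix_inv S ** (S ** S ** A) ** S = mat 1\<close>.\<close>

lemma inv_sqrt_frame:
  fixes U :: "real^'n^'d"
  assumes "frame U"
  defines "S \<equiv> inv_sqrt (U ** transpose U)"
  shows "invertible S" "(S ** U) ** transpose (S ** U) = mat 1"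
proof -
  let ?A = "U ** transpose U"
  have sym: "transpose ?A = ?A" by (simp add: matrix_transpose_mul)
  have pd: "x \<bullet> (?A *v x) > 0" if "x \<noteq> 0" for x
  proof -
    have "transpose U *v x \<noteq> 0"
      using frame_columns_separate[OF assms(1), of x] that
      by (metis transpose_mult_component zero_index)
    moreover have "x \<bullet> (?A *v x) = (transpose U *v x) \<bullet> (transpose U *v x)"
      by (metis inner_transpose_mult matrix_vector_mul_assoc transpose_transpose)
    ultimately show ?thesis by (metis inner_gt_zero_iff)
  qed
  have S: "transpose S = S" "x \<noteq> 0 \<Longrightarrow> x \<bullet> (S *v x) > 0" "S ** S = matrix_inv ?A" for x
    unfolding S_def using inv_sqrt_pd[of ?A] sym pd by simp_all
  have inv_A: "matrix_inv ?A ** ?A = mat 1"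
    using pd by (intro matrix_inv_mult(2) invertible_if_pd)
  show inv: "invertible S" using S(2) by (rule invertible_if_pd)
  have "(S ** U) ** transpose (S ** U) = S ** ?A ** S"
    by (simp only: matrix_transpose_mul S(1) matrix_mul_assoc)
  also have "\<dots> = matrix_inv S ** (S ** S) ** ?A ** S"
    by (simp only: matrix_mul_assoc matrix_inv_mult(2)[OF inv] matrix_mul_lid)
  also have "\<dots> = matrix_inv S ** (matrix_inv ?A ** ?A) ** S"
    by (simp only: S(3) matrix_mul_assoc)
  also have "\<dots> = mat 1"
    by (simp only: inv_A matrix_mul_rid matrix_inv_mult(2)[OF inv])
  finally show "(S ** U) ** transpose (S ** U) = mat 1" .
qed

section \<open>Column submatrices and the bounds encoded in \<open>rho\<close>\<close>

lemma colsub_mult: "colsub U T *v y = (\<Sum>i\<in>T. y $ i *\<^sub>R column i U)"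
proof -
  have "colsub U T *v y = (\<Sum>i\<in>UNIV. if i \<in> T then y $ i *\<^sub>R column i U else 0)"
    unfolding matrix_mult_sum scalar_mult_eq_scaleR
    by (intro sum.cong) (auto simp: column_def colsub_def vec_eq_iff)
  then show ?thesis by (simp add: sum.If_cases)
qed

lemma transpose_colsub_mult: "(transpose (colsub U T) *v x) $ i = (if i \<in> T then column i U \<bullet> x else 0)"
  unfolding transpose_mult_component by (simp add: column_def colsub_def inner_vec_def)

lemma transpose_colsub_mult_inner:
  "(transpose (colsub U T) *v x) \<bullet> (transpose (colsub U T) *v x) = (\<Sum>i\<in>T. (column i U \<bullet> x)\<^sup>2)"
proof -
  have "(transpose (colsub U T) *v x) \<bullet> (transpose (colsub U T) *v x)
    = (\<Sum>i\<in>UNIV. if i \<in> T then (column i U \<bullet> x)\<^sup>2 else 0)"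
    unfolding inner_vec_def transpose_colsub_mult by (intro sum.cong) (auto simp: power2_eq_square)
  then show ?thesis by (simp add: sum.If_cases)
qed

lemma range_colsub: "range ((*v) (colsub U T)) = span ((\<lambda>i. column i U) ` T)"
proof
  show "range ((*v) (colsub U T)) \<subseteq> span ((\<lambda>i. column i U) ` T)"
    unfolding colsub_mult by (auto intro!: span_sum intro: span_scale span_base)
  have "column i U \<in> range ((*v) (colsub U T))" if "i \<in> T" for i
  proof (rule range_eqI)
    show "column i U = colsub U T *v axis i 1"
      using that unfolding colsub_mult by (simp add: axis_def if_distrib[of "\<lambda>a. a *\<^sub>R _"] cong: if_cong)
  qed
  then show "span ((\<lambda>i. column i U) ` T) \<subseteq> range ((*v) (colsub U T))"
    by (intro span_minimal linear_subspace_image[OF matrix_vector_mul_linear]) auto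
qed

lemma rhoT_le_rho:
  assumes "T \<noteq> {}" shows "rhoT U T \<le> rho U"
proof -
  have "finite {rhoT U T | T. T \<noteq> {}}" by simp
  then show ?thesis unfolding rho_def using assms by (intro Max_ge) auto
qed

lemma rho_leI:
  fixes U :: "real^'n^'d"
  assumes "\<And>T. T \<noteq> {} \<Longrightarrow> rhoT U T \<le> r" shows "rho U \<le> r"
proof -
  have "rhoT U UNIV \<in> {rhoT U T | T. T \<noteq> {}}" by blast
  then have "{rhoT U T | T. T \<noteq> {}} \<noteq> {}" by blast
  then show ?thesis unfolding rho_def using assms by (subst Max_le_iff) auto
qed

text \<open>The form in which \<open>rho\<close> feeds the estimates: \<open>1 + rhoT U T\<close> is
  a squared pseudo-inverse norm by definition, and the span is the range of
  \<open>colsub V T\<close>.\<close>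

lemma inner_self_le_rho:
  fixes U :: "real^'n^'d"
  defines "V \<equiv> inv_sqrt (U ** transpose U) ** U"
  assumes "T \<noteq> {}" and "x \<in> span ((\<lambda>i. column i V) ` T)"
  shows "x \<bullet> x \<le> (1 + rho U) * (\<Sum>i\<in>T. (column i V \<bullet> x)\<^sup>2)"
proof -
  obtain y where "x = colsub V T *v y" using assms(3) range_colsub by blast
  from inner_self_le_opnorm_pinv[OF this]
  have "x \<bullet> x \<le> (opnorm (pinv (colsub V T)))\<^sup>2 * (\<Sum>i\<in>T. (column i V \<bullet> x)\<^sup>2)"
    by (simp only: transpose_colsub_mult_inner)
  also have "\<dots> \<le> (1 + rho U) * (\<Sum>i\<in>T. (column i V \<bullet> x)\<^sup>2)"
    using rhoT_le_rho[OF assms(2), of U] unfolding rhoT_def V_def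
    by (intro mult_right_mono sum_nonneg) auto
  finally show ?thesis .
qed

section \<open>Parseval frames\<close>

lemma parseval_expand:
  fixes V :: "real^'n^'d"
  assumes "V ** transpose V = mat 1"
  shows "x = (\<Sum>i\<in>UNIV. (column i V \<bullet> x) *\<^sub>R column i V)"
proof -
  have "x = V *v (transpose V *v x)"
    by (simp only: matrix_vector_mul_assoc assms matrix_vector_mul_lid)
  then show ?thesis unfolding matrix_mult_sum[of V] scalar_mult_eq_scaleR transpose_mult_component .
qed

lemma parseval_inner:
  fixes V :: "real^'n^'d"
  assumes "V ** transpose V = mat 1"
  shows "x \<bullet> x = (\<Sum>i\<in>UNIV. (column i V \<bullet> x)\<^sup>2)"
  by (subst parseval_expand[OF assms, of x])
    (simp add: inner_sum_left power2_eq_square)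

lemma parseval_frame:
  fixes V :: "real^'n^'d"
  assumes "V ** transpose V = mat 1"
  shows "frame V"
  unfolding frame_def full_rank_surjective matrix_right_invertible_surjective[symmetric]
  using assms by blast

text \<open>The term \<open>i = j\<close> in Parseval's identity for \<open>column j V\<close> gives
  \<open>?t\<^sup>2 \<le> ?t\<close>.\<close>

lemma parseval_column_le_1:
  fixes V :: "real^'n^'d"
  assumes "V ** transpose V = mat 1"
  shows "column j V \<bullet> column j V \<le> 1"
proof (rule ccontr)
  let ?t = "column j V \<bullet> column j V"
  assume "\<not> ?t \<le> 1"
  then have "?t * 1 < ?t * ?t" by (intro mult_strict_left_mono) auto
  moreover have "?t\<^sup>2 \<le> (\<Sum>i\<in>UNIV. (column i V \<bullet> column j V)\<^sup>2)" by (rule member_le_sum) auto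
  then have "?t\<^sup>2 \<le> ?t" by (simp only: parseval_inner[OF assms, symmetric])
  then have "?t * ?t \<le> ?t * 1" by (simp only: power2_eq_square mult_1_right)
  ultimately show False by linarith
qed

lemma sum_UNIV_split:
  fixes f :: "'n::finite \<Rightarrow> 'a::comm_monoid_add"
  shows "(\<Sum>i\<in>UNIV. f i) = f j + (\<Sum>i\<in>-{j}. f i)"
  unfolding Compl_eq_Diff_UNIV by (rule sum.remove) auto

text \<open>A column with squared norm strictly between 0 and 1 is badly conditioned either on its own
  or through the complement of its index.\<close>
lemma rho_ge_1:
  fixes U :: "real^'n^'d"
  assumes "frame U"
  defines "V \<equiv> inv_sqrt (U ** transpose U) ** U"
  assumes "column j V \<noteq> 0" "column j V \<bullet> column j V \<noteq> 1"
  shows "rho U \<ge> 1"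
proof -
  define v where "v = column j V"
  define t where "t = v \<bullet> v"
  have P: "V ** transpose V = mat 1" unfolding V_def by (rule inv_sqrt_frame[OF assms(1)])
  have t: "0 < t" "t < 1"
    using assms(3,4) parseval_column_le_1[OF P, of j] by (auto simp: t_def v_def)
  have "t \<le> (1 + rho U) * t\<^sup>2"
    using inner_self_le_rho[of "{j}" v U] by (simp add: V_def[symmetric] v_def[symmetric] t_def span_base)
  then have 1: "1 \<le> (1 + rho U) * t" using t by (simp add: power2_eq_square)
  have sum: "t = t\<^sup>2 + (\<Sum>i\<in>-{j}. (column i V \<bullet> v)\<^sup>2)"
    using parseval_inner[OF P, of v] by (simp add: t_def v_def sum_UNIV_split[of _ j])
  \<comment> \<open>The bound from \<open>rho\<close> requires a nonempty index set.\<close>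
  have "-{j} \<noteq> {}"
  proof
    assume "-{j} = {}"
    with sum have "t = t\<^sup>2" by simp
    then show False using t by (simp add: power2_eq_square)
  qed
  moreover have "v \<in> span ((\<lambda>i. column i V) ` (-{j}))"
  proof -
    \<comment> \<open>The expansion of \<open>v\<close> contains \<open>v\<close> itself with
      coefficient \<open>t < 1\<close>, so it can be solved for \<open>v\<close>.\<close>
    have "v = t *\<^sub>R v + (\<Sum>i\<in>-{j}. (column i V \<bullet> v) *\<^sub>R column i V)"
      using parseval_expand[OF P, of v] by (simp add: t_def v_def sum_UNIV_split[of _ j])
    then have "(1 - t) *\<^sub>R v = (\<Sum>i\<in>-{j}. (column i V \<bullet> v) *\<^sub>R column i V)"
      by (simp add: scaleR_left_diff_distrib diff_eq_eq add.commute)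
    moreover have "\<dots> \<in> span ((\<lambda>i. column i V) ` (-{j}))"
      by (intro span_sum span_scale span_base) auto
    ultimately have "(1 / (1 - t)) *\<^sub>R ((1 - t) *\<^sub>R v) \<in> span ((\<lambda>i. column i V) ` (-{j}))"
      by (metis span_scale)
    then show ?thesis using t by simp
  qed
  ultimately have "v \<bullet> v \<le> (1 + rho U) * (\<Sum>i\<in>-{j}. (column i V \<bullet> v)\<^sup>2)"
    using inner_self_le_rho[of "-{j}" v U] by (simp add: V_def[symmetric])
  then have "t \<le> (1 + rho U) * (t - t\<^sup>2)" 
    using sum unfolding t_def[symmetric] by (metis add_diff_cancel_left')
  then have "1 * t \<le> ((1 + rho U) * (1 - t)) * t" by (simp add: power2_eq_square algebra_simps)
  then have 2: "1 \<le> (1 + rho U) * (1 - t)" using t by simp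
  \<comment> \<open>The bounds from \<open>{j}\<close> and from its complement add up to
    \<open>2 \<le> 1 + rho U\<close>.\<close>
  have "(1 + rho U) * t + (1 + rho U) * (1 - t) = 1 + rho U" by (simp add: algebra_simps)
  with 1 2 show ?thesis by linarith
qed

text \<open>In Parseval's identity for a unit column its own term is already 1, so the other inner
  products vanish.\<close>

lemma parseval_columns_orthogonal:
  fixes V :: "real^'n^'d"
  assumes P: "V ** transpose V = mat 1"
    and unit: "\<And>j. column j V = 0 \<or> column j V \<bullet> column j V = 1"
    and "i \<noteq> j"
  shows "column i V \<bullet> column j V = 0"
proof (cases "column j V = 0")
  case False
  then have 1: "column j V \<bullet> column j V = 1" using unit by blast
  have "column j V \<bullet> column j V
      = (column j V \<bullet> column j V)\<^sup>2 + (\<Sum>i\<in>-{j}. (column i V \<bullet> column j V)\<^sup>2)"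
    using parseval_inner[OF P, of "column j V"] unfolding sum_UNIV_split[of _ j] .
  then have "(\<Sum>i\<in>-{j}. (column i V \<bullet> column j V)\<^sup>2) = 0"
    unfolding 1 power_one by linarith
  then have "\<forall>i\<in>-{j}. (column i V \<bullet> column j V)\<^sup>2 = 0" by (subst (asm) sum_nonneg_eq_0_iff) auto
  then show ?thesis using assms(3) by simp
qed simp

text \<open>By orthogonality \<open>(1 / z $ j) *\<^sub>R column j V\<close> solves the system, and
  the weight cancels from the score.\<close>

lemma lev_unit_parseval:
  fixes V :: "real^'n^'d"
  assumes P: "V ** transpose V = mat 1"
    and unit: "\<And>j. column j V = 0 \<or> column j V \<bullet> column j V = 1"
    and z: "\<And>j. z $ j > 0"
  shows "lev V z j = column j V \<bullet> column j V"
proof (cases "column j V = 0")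
  case False
  then have 1: "column j V \<bullet> column j V = 1" using unit by blast
  have "(V ** diag_mat z ** transpose V) *v ((1 / z $ j) *\<^sub>R column j V)
      = (\<Sum>i\<in>UNIV. if i = j then column j V else 0)"
    unfolding frame_operator_mult using z[of j] 1
    by (intro sum.cong) (auto simp: parseval_columns_orthogonal[OF P unit])
  also have "\<dots> = column j V" by simp
  finally show ?thesis using lev_eqI[OF parseval_frame[OF P] z] 1 z[of j] by simp
qed (simp add: lev_def)

text \<open>When the nonzero columns are orthonormal, each \<open>A = colsub V T\<close> is a
  partial isometry. Hence \<open>pinv A = transpose A\<close> has norm at most 1, and no
  \<open>rhoT U T\<close> is positive.\<close>

lemma rho_unit_parseval:
  fixes U :: "real^'n^'d"
  assumes "frame U"
  defines "V \<equiv> inv_sqrt (U ** transpose U) ** U"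
  assumes unit: "\<And>j. column j V = 0 \<or> column j V \<bullet> column j V = 1"
  shows "rho U = 0"
proof (rule antisym)
  have P: "V ** transpose V = mat 1" unfolding V_def by (rule inv_sqrt_frame[OF assms(1)])
  show "rho U \<le> 0"
  proof (rule rho_leI)
    fix T :: "'n set"
    define A where "A = colsub V T"
    have AAA: "A *v (transpose A *v (A *v y)) = A *v y" for y
    proof -
      have "(column i V \<bullet> (A *v y)) *\<^sub>R column i V = y $ i *\<^sub>R column i V" if "i \<in> T" for i
      proof -
        have "column i V \<bullet> (A *v y) = (\<Sum>k\<in>T. if k = i then y $ i * (column i V \<bullet> column i V) else 0)"
          unfolding A_def colsub_mult inner_sum_right
          by (intro sum.cong) (auto simp: parseval_columns_orthogonal[OF P unit])
        also have "\<dots> = y $ i * (column i V \<bullet> column i V)" using that by simp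
        finally show ?thesis using unit[of i] by auto
      qed
      then have "(\<Sum>i\<in>T. (column i V \<bullet> (A *v y)) *\<^sub>R column i V) = A *v y"
        unfolding A_def colsub_mult[of V T y] by (rule sum.cong[OF refl])
      moreover have "A *v (transpose A *v (A *v y)) = (\<Sum>i\<in>T. (column i V \<bullet> (A *v y)) *\<^sub>R column i V)"
        unfolding A_def colsub_mult[of V T "transpose _ *v _"] transpose_colsub_mult by simp
      ultimately show ?thesis by simp
    qed
    then have 1: "A ** transpose A ** A = A"
      unfolding matrix_eq matrix_vector_mul_assoc[symmetric] by blast
    from arg_cong[OF this, of transpose] have 2: "transpose A ** A ** transpose A = transpose A"
      by (simp only: matrix_transpose_mul transpose_transpose matrix_mul_assoc)
    have pinv: "pinv A = transpose A"
      by (rule pinv_eqI[OF 1 2]) (simp_all only: matrix_transpose_mul transpose_transpose)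
    have "norm (transpose A *v x) \<le> 1 * norm x" for x
    proof -
      have "(norm (transpose A *v x))\<^sup>2 = (\<Sum>i\<in>T. (column i V \<bullet> x)\<^sup>2)"
        unfolding A_def by (simp only: transpose_colsub_mult_inner power2_norm_eq_inner)
      also have "\<dots> \<le> (\<Sum>i\<in>UNIV. (column i V \<bullet> x)\<^sup>2)" by (intro sum_mono2) auto
      also have "\<dots> = (norm x)\<^sup>2" by (simp only: parseval_inner[OF P, of x] power2_norm_eq_inner)
      finally show ?thesis unfolding mult_1 by (rule power2_le_imp_le) simp
    qed
    then have "opnorm (pinv A) \<le> 1" unfolding pinv opnorm_def by (rule onorm_bound[rotated]) simp
    moreover have "0 \<le> opnorm (pinv A)"
      unfolding opnorm_def by (intro onorm_pos_le matrix_vector_mul_bounded_linear)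
    ultimately show "rhoT U T \<le> 0"
      unfolding rhoT_def V_def[symmetric] A_def[symmetric] by (simp add: power_le_one)
  qed
  \<comment> \<open>For the reverse inequality, \<open>b\<close> lies in the span of all columns,
    and Parseval turns the bound for \<open>UNIV\<close> into
    \<open>1 \<le> 1 + rho U\<close>.\<close>
  obtain b :: "real^'d" where "b \<in> Basis" using nonempty_Basis by blast
  have "colsub V UNIV = V" by (simp add: colsub_def vec_eq_iff)
  then have "b \<in> range ((*v) (colsub V UNIV))"
    using parseval_frame[OF P] unfolding frame_def full_rank_surjective by (metis UNIV_I)
  then have "b \<in> span ((\<lambda>i. column i V) ` UNIV)" by (simp only: range_colsub)
  then have "b \<bullet> b \<le> (1 + rho U) * (b \<bullet> b)"
    unfolding parseval_inner[OF P, of b] V_def using inner_self_le_rho[of UNIV b U] parseval_inner[OF P, of b]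
    by (metis V_def UNIV_not_empty)
  then show "0 \<le> rho U" using \<open>b \<in> Basis\<close> by (simp add: inner_same_Basis)
qed

section \<open>Shrinking gaps between weights\<close>

definition scale_on :: "'n set \<Rightarrow> real \<Rightarrow> real^'n \<Rightarrow> real^'n" where
  "scale_on T c z = (\<chi> i. if i \<in> T then c * z $ i else z $ i)"

lemma scale_on_nth [simp]: "scale_on T c z $ i = (if i \<in> T then c * z $ i else z $ i)"
  by (simp add: scale_on_def)

lemma wquad_mono:
  assumes "\<And>i. z $ i \<le> w $ i" shows "wquad U z x \<le> wquad U w x"
  unfolding wquad_def by (intro sum_mono mult_right_mono assms) auto

lemma wquad_vec_scaleR: "wquad U (c *\<^sub>R z) x = c * wquad U z x"
  unfolding wquad_def by (simp add: sum_distrib_left mult.assoc)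

text \<open>With \<open>x\<close> optimal for the scaled weights, test \<open>z\<close> at
  \<open>c *\<^sub>R x\<close>: the factor \<open>c\<close> moves from the weight to the test
  vector, and \<open>c * wquad U z x \<le> wquad U (scale_on T c z) x\<close> controls the quadratic
  term.\<close>

lemma lev_scale_on_le:
  fixes U :: "real^'n^'d"
  assumes U: "frame U" and z: "\<And>j. z $ j > 0" and c: "0 < c" "c \<le> 1" and j: "j \<in> T"
  shows "lev U (scale_on T c z) j \<le> lev U z j"
proof -
  let ?w = "scale_on T c z"
  have w: "?w $ i > 0" for i using z c by simp
  obtain x where x: "lev U ?w j = ?w $ j * (2 * (column j U \<bullet> x) - wquad U ?w x)"
    using lev_eq_dual[OF U w] by metis
  have "c * wquad U z x \<le> wquad U ?w x" unfolding wquad_vec_scaleR[symmetric]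
    using z c by (intro wquad_mono) (simp add: mult_left_le_one_le less_imp_le)
  then have "c * (c * wquad U z x) \<le> c * wquad U ?w x" using c by simp
  then have "z $ j * (2 * c * (column j U \<bullet> x) - c * wquad U ?w x)
      \<le> z $ j * (2 * (column j U \<bullet> (c *\<^sub>R x)) - wquad U z (c *\<^sub>R x))"
    using z[of j] by (intro mult_left_mono) (auto simp: wquad_scaleR power2_eq_square mult.assoc)
  also have "\<dots> \<le> lev U z j" by (rule lev_ge_dual[OF U z])
  finally show ?thesis unfolding x using j by (simp add: algebra_simps)
qed

text \<open>The optimiser for \<open>z\<close> is tested against the scaled weights: the weight of
  \<open>j\<close> is unchanged and the quadratic form does not grow.\<close>

lemma lev_scale_on_ge:
  fixes U :: "real^'n^'d"
  assumes U: "frame U" and z: "\<And>j. z $ j > 0" and c: "0 < c" "c \<le> 1" and j: "j \<notin> T"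
  shows "lev U z j \<le> lev U (scale_on T c z) j"
proof -
  let ?w = "scale_on T c z"
  have w: "?w $ i > 0" for i using z c by simp
  obtain x where x: "lev U z j = z $ j * (2 * (column j U \<bullet> x) - wquad U z x)"
    using lev_eq_dual[OF U z] by metis
  have "wquad U ?w x \<le> wquad U z x"
    using z c by (intro wquad_mono) (simp add: mult_left_le_one_le less_imp_le)
  then have "lev U z j \<le> ?w $ j * (2 * (column j U \<bullet> x) - wquad U ?w x)"
    unfolding x using j z[of j] by simp
  also have "\<dots> \<le> lev U ?w j" by (rule lev_ge_dual[OF U w])
  finally show ?thesis .
qed

text \<open>Testing the dual formula at the projection onto the span of the columns in \<open>T\<close> of the
  optimiser for \<open>z\<close>: on that span the weights outside \<open>T\<close> cost at most a \<open>\<delta>\<close>-fraction of those in \<open>T\<close>.\<close>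
lemma lev_scale_on_gap:
  fixes V :: "real^'n^'d"
  assumes P: "V ** transpose V = mat 1" and r: "r > 0"
    and cond: "\<And>x. x \<in> span ((\<lambda>i. column i V) ` T) \<Longrightarrow> x \<bullet> x \<le> (1 + r) * (\<Sum>i\<in>T. (column i V \<bullet> x)\<^sup>2)"
    and z: "\<And>j. z $ j > 0" and c: "0 < c" and \<delta>: "0 < \<delta>"
    and gap: "\<And>i k. i \<in> T \<Longrightarrow> k \<notin> T \<Longrightarrow> r * z $ k \<le> \<delta> * (c * z $ i)"
    and j: "j \<in> T"
  shows "lev V z j \<le> (1 + \<delta>) * lev V (scale_on T c z) j"
proof -
  let ?w = "scale_on T c z" and ?q = "\<lambda>A x. \<Sum>i\<in>A. z $ i * (column i V \<bullet> x)\<^sup>2"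
  have w: "?w $ i > 0" for i using z c by simp
  have V: "frame V" using P by (rule parseval_frame)
  have q_nonneg: "0 \<le> ?q A x" for A x using z by (intro sum_nonneg mult_nonneg_nonneg) (auto simp: less_imp_le)
  have split: "(\<Sum>i\<in>UNIV. f i) = (\<Sum>i\<in>T. f i) + (\<Sum>i\<in>-T. f i)" for f :: "'n \<Rightarrow> real"
    by (subst sum.union_disjoint[symmetric]) auto
  obtain x where x: "lev V z j = z $ j * (2 * (column j V \<bullet> x) - wquad V z x)"
    using lev_eq_dual[OF V z] by metis
  obtain y y' where y: "y \<in> span ((\<lambda>i. column i V) ` T)" and xy: "x = y + y'"
    and y': "\<And>v. v \<in> span ((\<lambda>i. column i V) ` T) \<Longrightarrow> orthogonal y' v"
    using orthogonal_subspace_decomp_exists[of "(\<lambda>i. column i V) ` T" x] by metis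
  have same: "column i V \<bullet> y = column i V \<bullet> x" if "i \<in> T" for i
    using y'[of "column i V"] that by (simp add: xy inner_add_right orthogonal_def inner_commute span_base)
  \<comment> \<open>The gap condition is applied against the smallest scaled weight
    \<open>c * a\<close>, so that unweighted sums can be compared in between.\<close>
  define a where "a = Min ((\<lambda>i. z $ i) ` T)"
  have a_le: "a \<le> z $ i" if "i \<in> T" for i unfolding a_def using that by simp
  have "a \<in> (\<lambda>i. z $ i) ` T" unfolding a_def using j by (intro Min_in) auto
  then obtain i0 where i0: "i0 \<in> T" "a = z $ i0" by blast
  have "r * ?q (-T) y = (\<Sum>k\<in>-T. r * z $ k * (column k V \<bullet> y)\<^sup>2)"
    by (simp add: sum_distrib_left mult.assoc)
  also have "\<dots> \<le> (\<Sum>k\<in>-T. \<delta> * (c * a) * (column k V \<bullet> y)\<^sup>2)"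
    using gap i0 by (intro sum_mono mult_right_mono) auto
  also have "\<dots> = \<delta> * (c * a) * (\<Sum>k\<in>-T. (column k V \<bullet> y)\<^sup>2)" by (simp add: sum_distrib_left)
  also have "\<dots> \<le> \<delta> * (c * a) * (r * (\<Sum>i\<in>T. (column i V \<bullet> y)\<^sup>2))"
  proof (intro mult_left_mono)
    \<comment> \<open>By Parseval the sum outside \<open>T\<close> is \<open>y \<bullet> y\<close>
      minus the sum over \<open>T\<close>, which turns the factor \<open>1 + r\<close> into
      \<open>r\<close>.\<close>
    show "(\<Sum>k\<in>-T. (column k V \<bullet> y)\<^sup>2) \<le> r * (\<Sum>i\<in>T. (column i V \<bullet> y)\<^sup>2)"
      using cond[OF y] parseval_inner[OF P, of y] unfolding split by (simp add: algebra_simps)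
    show "0 \<le> \<delta> * (c * a)" using \<delta> c z[of i0] i0 by simp
  qed
  also have "\<dots> = r * (\<delta> * c * (\<Sum>i\<in>T. a * (column i V \<bullet> y)\<^sup>2))"
    by (simp add: sum_distrib_left mult_ac)
  also have "\<dots> \<le> r * (\<delta> * c * ?q T y)"
    using r \<delta> c a_le by (intro mult_left_mono sum_mono mult_right_mono) auto
  finally have "?q (-T) y \<le> \<delta> * c * ?q T y" using r by simp
  moreover have "wquad V ?w y = c * ?q T y + ?q (-T) y"
    unfolding wquad_def split by (simp add: sum_distrib_left mult.assoc)
  moreover have "?q T y = ?q T x" by (rule sum.cong) (auto simp: same)
  moreover have "?q T x \<le> wquad V z x" unfolding wquad_def split using q_nonneg by simp
  then have "((1 + \<delta>) * c) * ?q T x \<le> ((1 + \<delta>) * c) * wquad V z x"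
    using \<delta> c by (intro mult_left_mono) auto
  ultimately have wq: "wquad V ?w y \<le> (1 + \<delta>) * c * wquad V z x" by (simp add: algebra_simps)
  define s where "s = 1 / ((1 + \<delta>) * c)"
  have s: "s > 0" "s * ((1 + \<delta>) * c) = 1" using \<delta> c by (auto simp: s_def)
  have "s\<^sup>2 * wquad V ?w y \<le> s\<^sup>2 * ((1 + \<delta>) * c * wquad V z x)" using wq by (intro mult_left_mono) auto
  also have "\<dots> = s * (s * ((1 + \<delta>) * c)) * wquad V z x" by (simp only: power2_eq_square mult_ac)
  finally have q: "wquad V ?w (s *\<^sub>R y) \<le> s * wquad V z x" unfolding wquad_scaleR s(2) by simp
  have "lev V z j = (s * ((1 + \<delta>) * c)) * (z $ j * (2 * (column j V \<bullet> x) - wquad V z x))"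
    unfolding x s(2) by simp
  also have "\<dots> = (1 + \<delta>) * (c * z $ j * (2 * (s * (column j V \<bullet> x)) - s * wquad V z x))"
    by (simp add: algebra_simps)
  also have "\<dots> \<le> (1 + \<delta>) * (?w $ j * (2 * (column j V \<bullet> (s *\<^sub>R y)) - wquad V ?w (s *\<^sub>R y)))"
    using q \<delta> c z[of j] j same[OF j] by (intro mult_left_mono) auto
  also have "\<dots> \<le> (1 + \<delta>) * lev V ?w j"
    using \<delta> by (intro mult_left_mono lev_ge_dual[OF V w]) auto
  finally show ?thesis .
qed

text \<open>Scores fall on \<open>T\<close>, rise off \<open>T\<close> and keep their total, so the
  change is twice the fall on \<open>T\<close>. That fall is at most \<delta> times the new scores,
  whose total is the dimension.\<close>

lemma sum_abs_lev_scale_on: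
  fixes V :: "real^'n^'d"
  assumes P: "V ** transpose V = mat 1" and r: "r > 0"
    and cond: "\<And>x. x \<in> span ((\<lambda>i. column i V) ` T) \<Longrightarrow> x \<bullet> x \<le> (1 + r) * (\<Sum>i\<in>T. (column i V \<bullet> x)\<^sup>2)"
    and z: "\<And>j. z $ j > 0" and c: "0 < c" "c \<le> 1" and \<delta>: "0 < \<delta>"
    and gap: "\<And>i k. i \<in> T \<Longrightarrow> k \<notin> T \<Longrightarrow> r * z $ k \<le> \<delta> * (c * z $ i)"
  shows "(\<Sum>j\<in>UNIV. \<bar>lev V z j - lev V (scale_on T c z) j\<bar>) \<le> 2 * real CARD('d) * \<delta>"
proof -
  let ?w = "scale_on T c z"
  define a b where "a = lev V z" and "b = lev V ?w"
  have V: "frame V" using P by (rule parseval_frame)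
  have w: "?w $ i > 0" for i using z c by simp
  have split: "(\<Sum>i\<in>UNIV. f i) = (\<Sum>i\<in>T. f i) + (\<Sum>i\<in>-T. f i)" for f :: "'n \<Rightarrow> real"
    by (subst sum.union_disjoint[symmetric]) auto
  have "(\<Sum>j\<in>UNIV. \<bar>a j - b j\<bar>) = (\<Sum>j\<in>T. a j - b j) + (\<Sum>j\<in>-T. b j - a j)"
    unfolding split
    using lev_scale_on_le[OF V z c] lev_scale_on_ge[OF V z c]
    by (intro arg_cong2[of _ _ _ _ "(+)"] sum.cong) (auto simp: a_def b_def)
  also have "(\<Sum>j\<in>-T. b j - a j) = (\<Sum>j\<in>T. a j - b j)"
    using sum_lev[OF V z] sum_lev[OF V w] unfolding a_def b_def split by (simp add: sum_subtractf)
  also have "(\<Sum>j\<in>T. a j - b j) \<le> (\<Sum>j\<in>T. \<delta> * b j)"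
    using lev_scale_on_gap[OF P r cond z c(1) \<delta> gap]
    by (intro sum_mono) (simp add: a_def b_def algebra_simps)
  also have "\<dots> \<le> (\<Sum>j\<in>UNIV. \<delta> * b j)"
    using lev_nonneg[OF V w] \<delta> by (intro sum_mono2) (auto simp: b_def)
  also have "\<dots> = CARD('d) * \<delta>"
    using sum_lev[OF V w] by (simp add: sum_distrib_left[symmetric] b_def)
  finally show ?thesis by (simp add: a_def b_def mult_ac)
qed

section \<open>Counting and closing gaps\<close>

definition gaps :: "real \<Rightarrow> real^'n \<Rightarrow> 'n set set" where
  "gaps g z = {T. T \<noteq> {} \<and> T \<noteq> UNIV \<and> (\<forall>i\<in>T. \<forall>k\<in>-T. g * z $ k < z $ i)}"

text \<open>An index only in \<open>S\<close> and an index only in \<open>T\<close> would each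
  outweigh the other, impossible for \<open>g \<ge> 1\<close>. So the gaps form a chain and
  \<open>card\<close> is injective on them; with the empty and the full set excluded, the sizes run
  from 1 to \<open>CARD('n) - 1\<close>.\<close>

lemma gaps_card_less:
  fixes z :: "real^'n"
  assumes g: "g \<ge> 1" and z: "\<And>j. z $ j > 0"
  shows "card (gaps g z) < CARD('n)"
proof -
  have chain: "S \<subseteq> T \<or> T \<subseteq> S" if "S \<in> gaps g z" "T \<in> gaps g z" for S T
  proof (rule ccontr)
    assume "\<not> (S \<subseteq> T \<or> T \<subseteq> S)"
    then obtain i k where ik: "i \<in> S" "i \<notin> T" "k \<in> T" "k \<notin> S" by blast
    then have "g * z $ k < z $ i" "g * z $ i < z $ k" using that by (auto simp: gaps_def)
    moreover have "1 * z $ k \<le> g * z $ k" "1 * z $ i \<le> g * z $ i"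
      using g z by (intro mult_right_mono; simp add: less_imp_le)+
    ultimately show False by linarith
  qed
  have "inj_on card (gaps g z)"
  proof (rule inj_onI)
    fix S T assume *: "S \<in> gaps g z" "T \<in> gaps g z" "card S = card T"
    from chain[OF *(1,2)] show "S = T"
      using card_subset_eq[of T S] card_subset_eq[of S T] *(3) by (elim disjE) simp_all
  qed
  moreover have "card T \<in> {1..<CARD('n)}" if "T \<in> gaps g z" for T
  proof -
    have "T \<noteq> {}" "T \<subset> UNIV" using that by (auto simp: gaps_def)
    then show ?thesis using psubset_card_mono[of UNIV T] by (simp add: Suc_le_eq card_gt_0_iff)
  qed
  ultimately have "card (gaps g z) \<le> card {1..<CARD('n)}"
    by (intro card_inj_on_le[of card]) auto
  also have "\<dots> < CARD('n)" using zero_less_card_finite[where 'a='n] by simp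
  finally show ?thesis .
qed

text \<open>Closing the gap \<open>T\<close> opens no other, so the number of gaps can serve as an
  induction measure.\<close>

lemma gaps_scale_on:
  fixes z :: "real^'n"
  assumes g: "g \<ge> 1" and z: "\<And>j. z $ j > 0" and T: "T \<in> gaps g z"
  obtains c where "0 < c" "c \<le> 1" "\<And>i k. i \<in> T \<Longrightarrow> k \<notin> T \<Longrightarrow> g * z $ k \<le> c * z $ i"
    "gaps g (scale_on T c z) \<subset> gaps g z"
proof -
  define R where "R = (\<lambda>(i, k). g * z $ k / z $ i) ` (T \<times> -T)"
  have fin: "finite R" "R \<noteq> {}" using T by (auto simp: R_def gaps_def)
  \<comment> \<open>At the maximising pair the factor becomes exactly \<open>g\<close>, which
    violates the strict inequality for \<open>T\<close>; every pair across \<open>T\<close> keeps a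
    factor of at least \<open>g\<close>.\<close>
  define c where "c = Max R"
  have "c \<in> R" unfolding c_def using fin by (rule Max_in)
  then obtain i0 k0 where ik0: "i0 \<in> T" "k0 \<notin> T" "c = g * z $ k0 / z $ i0" by (auto simp: R_def)
  have c0: "0 < c" using ik0 z g by simp
  have c1: "c \<le> 1" using ik0 z[of i0] T by (auto simp: gaps_def less_imp_le)
  have le: "g * z $ k \<le> c * z $ i" if "i \<in> T" "k \<notin> T" for i k
  proof -
    have "g * z $ k / z $ i \<in> R" using that by (auto simp: R_def)
    then have "g * z $ k / z $ i \<le> c" unfolding c_def using fin by simp
    then show ?thesis using z[of i] by (simp add: divide_le_eq)
  qed
  let ?w = "scale_on T c z"
  have w: "?w $ i > 0" for i using z c0 by simp
  have g_le: "z $ i \<le> g * z $ i" "?w $ i \<le> g * ?w $ i" for i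
    using mult_right_mono[OF g less_imp_le[OF z[of i]]] mult_right_mono[OF g less_imp_le[OF w[of i]]]
    by (simp_all only: mult_1_left)
  have "S \<in> gaps g z" if S: "S \<in> gaps g ?w" for S
  proof -
    have Sgap: "g * ?w $ k < ?w $ i" if "i \<in> S" "k \<notin> S" for i k
      using S that by (auto simp: gaps_def)
    have "g * z $ k < z $ i" if "i \<in> S" "k \<notin> S" for i k
    proof -
      \<comment> \<open>On one side of \<open>T\<close> the scaling cancels or is absent; from
        inside to outside, \<open>T\<close> was a gap of \<open>z\<close> already; from outside to
        inside is contradictory, as the scaled weights in \<open>T\<close> still dominate.\<close>
      consider "i \<in> T" "k \<in> T" | "i \<in> T" "k \<notin> T" | "i \<notin> T" "k \<in> T" | "i \<notin> T" "k \<notin> T" by blast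
      then show ?thesis
      proof cases
        case 1
        then have "c * (g * z $ k) < c * z $ i" using Sgap[OF that] by (simp add: mult_ac)
        then show ?thesis using c0 by simp
      next
        case 2
        then show ?thesis using T by (auto simp: gaps_def)
      next
        case 3
        have "g * z $ i \<le> c * z $ k" using le 3 by simp
        moreover have "g * (c * z $ k) < z $ i" using Sgap[OF that] 3 by simp
        moreover have "c * z $ k \<le> g * (c * z $ k)" using g_le(2)[of k] 3 by simp
        ultimately show ?thesis using g_le(1)[of i] by linarith
      next
        case 4
        then show ?thesis using Sgap[OF that] by simp
      qed
    qed
    then show ?thesis using S by (auto simp: gaps_def)
  qed
  moreover have "T \<notin> gaps g ?w"
  proof
    assume "T \<in> gaps g ?w"
    then have "g * ?w $ k0 < ?w $ i0" using ik0(1,2) by (auto simp: gaps_def)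
    then show False using ik0 z[of i0] by simp
  qed
  ultimately have "gaps g ?w \<subset> gaps g z" using T by blast
  with c0 c1 le show ?thesis by (rule that)
qed

text \<open>The set \<open>T m\<close> holds the indices whose weight is within a factor
  \<open>g ^ m\<close> below \<open>z $ i\<close> or larger. While it is proper it is not a gap, so
  some index outside has weight within a factor \<open>g\<close> of a member and joins
  \<open>T (Suc m)\<close>.\<close>

lemma gaps_empty_ratio:
  fixes z :: "real^'n"
  assumes g: "g \<ge> 1" and z: "\<And>j. z $ j > 0" and no: "gaps g z = {}"
  shows "z $ i \<le> g ^ CARD('n) * z $ k"
proof -
  define T where "T m = {k. z $ i \<le> g ^ m * z $ k}" for m :: nat
  have mono: "T m \<subseteq> T (Suc m)" for m
  proof
    fix k assume "k \<in> T m"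
    then have "z $ i \<le> 1 * (g ^ m * z $ k)" by (simp add: T_def)
    also have "\<dots> \<le> g * (g ^ m * z $ k)"
      using g less_imp_le[OF z[of k]] by (intro mult_right_mono mult_nonneg_nonneg) simp_all
    finally show "k \<in> T (Suc m)" by (simp add: T_def mult.assoc)
  qed
  \<comment> \<open>At \<open>m = CARD('n)\<close> the second alternative is impossible, which
    leaves \<open>UNIV\<close>.\<close>
  have "T m = UNIV \<or> m < card (T m)" for m
  proof (induction m)
    case 0
    have "i \<in> T 0" by (simp add: T_def)
    then show ?case by (metis card_gt_0_iff empty_iff finite)
  next
    case (Suc m)
    show ?case
    proof (cases "T m = UNIV")
      case True
      then show ?thesis using mono[of m] by blast
    next
      case False
      then have "m < card (T m)" using Suc by simp
      then have "T m \<noteq> {}" by (metis card.empty not_less_zero)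
      moreover have "T m \<notin> gaps g z" unfolding no by simp
      ultimately have "\<not> (\<forall>j\<in>T m. \<forall>k\<in>- T m. g * z $ k < z $ j)"
        using False unfolding gaps_def mem_Collect_eq by iprover
      then obtain j k where jk: "j \<in> T m" "k \<notin> T m" "\<not> g * z $ k < z $ j" by blast
      have "z $ i \<le> g ^ m * z $ j" using jk by (simp add: T_def)
      also have "\<dots> \<le> g ^ m * (g * z $ k)" using jk(3) g by (intro mult_left_mono) (simp_all add: not_less)
      finally have "k \<in> T (Suc m)" by (simp add: T_def mult_ac)
      then have "T m \<subset> T (Suc m)" using mono[of m] jk(2) by blast
      then have "card (T m) < card (T (Suc m))" by (intro psubset_card_mono) auto
      with \<open>m < card (T m)\<close> show ?thesis by linarith
    qed
  qed
  from this[of "CARD('n)"] have "T (CARD('n)) = UNIV"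
    using card_mono[OF finite subset_UNIV, of "T CARD('n)"] by linarith
  then have "k \<in> T CARD('n)" by simp
  then show ?thesis by (simp add: T_def)
qed

text \<open>Induction on the number of gaps: closing one costs
  \<open>2 * real CARD('d) * \<delta>\<close>, and the triangle inequality adds the costs. The
  assumption \<open>\<delta> \<le> r\<close> makes \<open>r / \<delta>\<close> an admissible gap
  factor.\<close>

lemma exists_gapless_weights:
  fixes V :: "real^'n^'d"
  assumes P: "V ** transpose V = mat 1" and r: "r > 0"
    and cond: "\<And>T x. T \<noteq> {} \<Longrightarrow> x \<in> span ((\<lambda>i. column i V) ` T) \<Longrightarrow>
      x \<bullet> x \<le> (1 + r) * (\<Sum>i\<in>T. (column i V \<bullet> x)\<^sup>2)"
    and \<delta>: "0 < \<delta>" "\<delta> \<le> r"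
    and z: "\<And>j. z $ j > 0"
  shows "\<exists>w. (\<forall>j. w $ j > 0) \<and> gaps (r / \<delta>) w = {} \<and>
    (\<Sum>j\<in>UNIV. \<bar>lev V z j - lev V w j\<bar>) \<le> card (gaps (r / \<delta>) z) * (2 * real CARD('d) * \<delta>)"
  using z
proof (induction "card (gaps (r / \<delta>) z)" arbitrary: z rule: less_induct)
  case (less z)
  have g: "r / \<delta> \<ge> 1" using \<delta> by simp
  show ?case
  proof (cases "gaps (r / \<delta>) z = {}")
    case True
    then show ?thesis using less.prems by (intro exI[of _ z]) auto
  next
    case False
    then obtain T where T: "T \<in> gaps (r / \<delta>) z" by blast
    then obtain c where c: "0 < c" "c \<le> 1" "\<And>i k. i \<in> T \<Longrightarrow> k \<notin> T \<Longrightarrow> r / \<delta> * z $ k \<le> c * z $ i"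
      "gaps (r / \<delta>) (scale_on T c z) \<subset> gaps (r / \<delta>) z"
      using gaps_scale_on[OF g less.prems] by metis
    let ?y = "scale_on T c z"
    have y: "?y $ j > 0" for j using less.prems c by simp
    have lt: "card (gaps (r / \<delta>) ?y) < card (gaps (r / \<delta>) z)"
      using c(4) by (intro psubset_card_mono) auto
    obtain w where w: "\<forall>j. w $ j > 0" "gaps (r / \<delta>) w = {}"
      "(\<Sum>j\<in>UNIV. \<bar>lev V ?y j - lev V w j\<bar>) \<le> card (gaps (r / \<delta>) ?y) * (2 * real CARD('d) * \<delta>)"
      using less.hyps[OF lt y] by blast
    have "T \<noteq> {}" using T by (simp add: gaps_def)
    have "r * z $ k \<le> \<delta> * (c * z $ i)" if "i \<in> T" "k \<notin> T" for i k
      using c(3)[OF that] \<delta>(1) by (simp add: field_simps)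
    then have "(\<Sum>j\<in>UNIV. \<bar>lev V z j - lev V ?y j\<bar>) \<le> 2 * real CARD('d) * \<delta>"
      using sum_abs_lev_scale_on[OF P r cond[OF \<open>T \<noteq> {}\<close>] less.prems c(1,2) \<delta>(1)] by blast
    moreover have "(\<Sum>j\<in>UNIV. \<bar>lev V z j - lev V w j\<bar>)
        \<le> (\<Sum>j\<in>UNIV. \<bar>lev V z j - lev V ?y j\<bar>) + (\<Sum>j\<in>UNIV. \<bar>lev V ?y j - lev V w j\<bar>)"
      unfolding sum.distrib[symmetric] by (intro sum_mono) auto
    ultimately have "(\<Sum>j\<in>UNIV. \<bar>lev V z j - lev V w j\<bar>)
        \<le> (real (card (gaps (r / \<delta>) ?y)) + 1) * (2 * real CARD('d) * \<delta>)"
      using w(3) unfolding distrib_right by linarith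
    \<comment> \<open>The strict drop in the number of gaps absorbs the \<open>+ 1\<close> paid for
      the current step.\<close>
    also have "\<dots> \<le> card (gaps (r / \<delta>) z) * (2 * real CARD('d) * \<delta>)"
      using lt \<delta>(1) by (intro mult_right_mono) auto
    finally show ?thesis using w by blast
  qed
qed

theorem theorem4p6:
  fixes U :: "real^'n^'d" and z :: "real^'n" and \<delta> :: real
  assumes "frame U"
    and "\<forall>j. z $ j > 0"
    and "0 < \<delta>" and "\<delta> \<le> 1"
  shows "\<exists>zh :: real^'n. (\<forall>j. zh $ j > 0) \<and>
           (\<Sum>j\<in>UNIV. \<bar>lev U z j - lev U zh j\<bar>) \<le> 2 * real CARD('n) * real CARD('d) * \<delta> \<and>
           ln (Max (range (\<lambda>j. zh $ j)) / Min (range (\<lambda>j. zh $ j)))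
             \<le> real CARD('n) * ln (rho U / \<delta>)"
proof -
  define V where "V = inv_sqrt (U ** transpose U) ** U"
  have P: "V ** transpose V = mat 1" unfolding V_def by (rule inv_sqrt_frame[OF assms(1)])
  have z: "z $ j > 0" for j using assms(2) by blast
  have lev_V: "lev V w j = lev U w j" if "\<And>j. w $ j > 0" for w j
    unfolding V_def by (rule lev_left_mult[OF assms(1) that inv_sqrt_frame(1)[OF assms(1)]])
  show ?thesis
  \<comment> \<open>The first case yields \<open>rho U \<ge> 1\<close>, hence a gap factor of at
    least 1; in the second the nonzero columns of \<open>V\<close> are orthonormal.\<close>
  proof (cases "\<exists>j. column j V \<noteq> 0 \<and> column j V \<bullet> column j V \<noteq> 1")
    case True
    then have rho: "rho U \<ge> 1" using rho_ge_1[OF assms(1)] unfolding V_def by blast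
    define g where "g = rho U / \<delta>"
    have g: "g \<ge> 1" using rho assms(3,4) by (simp add: g_def)
    obtain w where w: "\<forall>j. w $ j > 0" "gaps g w = {}"
      and dist: "(\<Sum>j\<in>UNIV. \<bar>lev V z j - lev V w j\<bar>) \<le> card (gaps g z) * (2 * real CARD('d) * \<delta>)"
      using exists_gapless_weights[OF P, of "rho U" \<delta> z] inner_self_le_rho[of _ _ U] rho assms(3,4) z
      unfolding V_def[symmetric] g_def by fastforce
    note dist
    also have "card (gaps g z) * (2 * real CARD('d) * \<delta>) \<le> CARD('n) * (2 * real CARD('d) * \<delta>)"
      using gaps_card_less[OF g z] assms(3) by (intro mult_right_mono) auto
    finally have "(\<Sum>j\<in>UNIV. \<bar>lev U z j - lev U w j\<bar>) \<le> 2 * real CARD('n) * real CARD('d) * \<delta>"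
      using lev_V z w(1) by (simp add: mult_ac)
    moreover have "ln (Max (range (\<lambda>j. w $ j)) / Min (range (\<lambda>j. w $ j))) \<le> real CARD('n) * ln g"
    proof -
      have "Max (range (\<lambda>j. w $ j)) \<in> range (\<lambda>j. w $ j)" "Min (range (\<lambda>j. w $ j)) \<in> range (\<lambda>j. w $ j)"
        by (intro Max_in Min_in; simp)+
      then obtain i k where ik: "Max (range (\<lambda>j. w $ j)) = w $ i" "Min (range (\<lambda>j. w $ j)) = w $ k"
        unfolding image_iff by blast
      have "w $ i / w $ k \<le> g ^ CARD('n)"
        using gaps_empty_ratio[OF g _ w(2), of i k] w(1) by (simp add: divide_le_eq)
      then have "ln (w $ i / w $ k) \<le> ln (g ^ CARD('n))" using w(1) g by (subst ln_le_cancel_iff) auto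
      also have "\<dots> = real CARD('n) * ln g" using g by (simp add: ln_realpow)
      finally show ?thesis unfolding ik .
    qed
    ultimately show ?thesis using w(1) unfolding g_def by blast
  next
    case False
    then have unit: "column j V = 0 \<or> column j V \<bullet> column j V = 1" for j by blast
    \<comment> \<open>Scores do not depend on the weights in this case, so constant weights give
      distance 0 and logarithm \<open>ln 1 = 0\<close>.\<close>
    define w :: "real^'n" where "w = (\<chi> i. 1)"
    have w: "w $ j > 0" for j by (simp add: w_def)
    have "lev U z j = lev U w j" for j
      using lev_unit_parseval[OF P unit z] lev_unit_parseval[OF P unit w] lev_V z w by metis
    \<comment> \<open>here \<open>ln (rho U / \<delta>)\<close> takes the junk value \<open>ln 0 = 0\<close>\<close>
    moreover have "rho U = 0"
      using rho_unit_parseval[OF assms(1)] unit unfolding V_def by blast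
    ultimately show ?thesis using w assms(3) by (intro exI[of _ w]) (auto simp: w_def)
  qed
qed

end
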